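(* Let $a_1, \dots, a_n \in \mathbb{Z}_{>1}$, let $E = \bigcup_{i=1}^n a_i^\mathbb{N}$ where $a_i^\mathbb{N} = \{a_i^j : j \in \mathbb{N}\}$, let $M \in \mathbb{N}$, and let $f : \mathbb{Z}^M \to \mathbb{Z}$ be a Presburger-definable function. Then $f(E^M)$ has natural density zero.
   Context: $\mathbb{N}$ denotes the nonnegative integers. A set or function is Presburger-definable if it (respectively its graph) is first-order definable in $(\mathbb{Z}, <, +)$. For $A \subseteq \mathbb{Z}$, the upper natural density is $\limsup_{n\to\infty} \frac{|A \cap \{-n, \dots, n\}|}{2n+1}$ and the lower natural density is the corresponding $\liminf$; if they coincide, the common value is the natural density $d(A)$. *)

theory Defs
  imports Complex_Main "HOL-Library.Extended_Real"
begin

datatype pterm =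
    PVar nat
  | PAdd pterm pterm

datatype pform =
    PEq pterm pterm
  | PLess pterm pterm
  | PNot pform
  | PAnd pform pform
  | PEx nat pform

primrec peval :: "(nat \<Rightarrow> int) \<Rightarrow> pterm \<Rightarrow> int" where
  "peval v (PVar x) = v x"
| "peval v (PAdd s t) = peval v s + peval v t"

primrec psat :: "(nat \<Rightarrow> int) \<Rightarrow> pform \<Rightarrow> bool" where
  "psat v (PEq s t) \<longleftrightarrow> peval v s = peval v t"
| "psat v (PLess s t) \<longleftrightarrow> peval v s < peval v t"
| "psat v (PNot \<phi>) \<longleftrightarrow> \<not> psat v \<phi>"
| "psat v (PAnd \<phi> \<psi>) \<longleftrightarrow> psat v \<phi> \<and> psat v \<psi>"
| "psat v (PEx x \<phi>) \<longleftrightarrow> (\<exists>k. psat (v(x := k)) \<phi>)"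

primrec pvars :: "pterm \<Rightarrow> nat set" where
  "pvars (PVar x) = {x}"
| "pvars (PAdd s t) = pvars s \<union> pvars t"

primrec pfree :: "pform \<Rightarrow> nat set" where
  "pfree (PEq s t) = pvars s \<union> pvars t"
| "pfree (PLess s t) = pvars s \<union> pvars t"
| "pfree (PNot \<phi>) = pfree \<phi>"
| "pfree (PAnd \<phi> \<psi>) = pfree \<phi> \<union> pfree \<psi>"
| "pfree (PEx x \<phi>) = pfree \<phi> - {x}"

text \<open>
  Elements of \<open>\<int>\<^sup>k\<close> are integer lists of length \<open>k\<close>.  The default value \<open>0\<close> in
  \<open>pvaluation\<close> is irrelevant in \<open>presburger_definable\<close>, because all free variables of the
  defining formula are below \<open>k\<close>.  Parameters would add nothing: every integer is definable
  without parameters in this structure.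
\<close>

definition ivecs :: "nat \<Rightarrow> int set \<Rightarrow> int list set" where
  "ivecs k E = {xs. length xs = k \<and> set xs \<subseteq> E}"

definition pvaluation :: "int list \<Rightarrow> nat \<Rightarrow> int" where
  "pvaluation xs i = (if i < length xs then xs ! i else 0)"

definition presburger_definable :: "nat \<Rightarrow> int list set \<Rightarrow> bool" where
  "presburger_definable k S \<longleftrightarrow>
     (\<exists>\<phi>. pfree \<phi> \<subseteq> {..<k} \<and> S = {xs \<in> ivecs k UNIV. psat (pvaluation xs) \<phi>})"

text \<open>Only the values of \<open>f\<close> on lists of length \<open>M\<close> matter.\<close>

definition presburger_definable_fun :: "nat \<Rightarrow> (int list \<Rightarrow> int) \<Rightarrow> bool" where
  "presburger_definable_fun M f \<longleftrightarrow>
     presburger_definable (Suc M) {xs @ [f xs] | xs. xs \<in> ivecs M UNIV}"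

definition upper_natural_density :: "int set \<Rightarrow> ereal" where
  "upper_natural_density A =
     limsup (\<lambda>n. ereal (real (card (A \<inter> {- int n..int n})) / real (2 * n + 1)))"

definition lower_natural_density :: "int set \<Rightarrow> ereal" where
  "lower_natural_density A =
     liminf (\<lambda>n. ereal (real (card (A \<inter> {- int n..int n})) / real (2 * n + 1)))"

definition has_natural_density :: "int set \<Rightarrow> real \<Rightarrow> bool" where
  "has_natural_density A d \<longleftrightarrow>
     upper_natural_density A = ereal d \<and> lower_natural_density A = ereal d"

end

theory Submission
  imports Defs "HOL-Number_Theory.Number_Theory" "HOL-Computational_Algebra.Squarefree"
    "HOL-Decision_Procs.Cooper"
begin

text \<open>
  By quantifier elimination, each value \<open>y = f xs\<close> satisfies one of finitely many equations
  \<open>c * y = b\<^sub>1 x\<^sub>1 + \<dots> + b\<^sub>M x\<^sub>M + d\<close> with \<open>c \<noteq> 0\<close>. So it is enough to find moduli \<open>m\<close> modulo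
  which the elements of \<open>E\<close> take so few values that the \<open>M\<close>-th power of their number is
  negligible compared to \<open>m\<close>.

  Take \<open>m\<close> to be the product of all primes \<open>p\<close> with \<open>p - 1\<close> dividing \<open>L\<close>. By Fermat, powers of
  any integer are periodic modulo \<open>m\<close> with period \<open>L\<close>, and it remains to see that \<open>m\<close> can exceed
  any given power of \<open>L\<close> (a weak form of a theorem of Prachar). Averaging \<open>ln m\<close> over
  \<open>L = Q * l\<close> for \<open>l \<le> X\<close> gives about the sum over the primes \<open>p \<le> X\<close> of
  \<open>gcd (p - 1) Q * ln p / p\<close>. As \<open>gcd n Q\<close> is the sum of \<open>\<phi>(d)\<close> over the common divisors \<open>d\<close>,
  Mertens' theorem for primes congruent to 1 modulo \<open>d\<close> turns this into \<open>ln X\<close> times the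
  number of divisors of \<open>Q\<close>. For \<open>Q = 3 ^ J\<close> the relevant character groups are cyclic, and the
  only nontrivial real character is the one modulo 3, whose \<open>L\<close>-value is visibly nonzero.
\<close>

section \<open>Presburger functions are piecewise affine\<close>

primrec num_of_pterm :: "(nat \<Rightarrow> nat) \<Rightarrow> pterm \<Rightarrow> num" where
  "num_of_pterm \<rho> (PVar x) = Bound (\<rho> x)"
| "num_of_pterm \<rho> (PAdd s t) = Add (num_of_pterm \<rho> s) (num_of_pterm \<rho> t)"

text \<open>The map \<open>\<rho>\<close> holds the current de Bruijn index of each named variable:
  a quantifier sends its own variable to 0 and shifts all others, so shadowed names are handled as
  well.\<close>

primrec fm_of_pform :: "(nat \<Rightarrow> nat) \<Rightarrow> pform \<Rightarrow> fm" where
  "fm_of_pform \<rho> (PEq s t) = Eq (Sub (num_of_pterm \<rho> s) (num_of_pterm \<rho> t))"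
| "fm_of_pform \<rho> (PLess s t) = Lt (Sub (num_of_pterm \<rho> s) (num_of_pterm \<rho> t))"
| "fm_of_pform \<rho> (PNot \<phi>) = Not (fm_of_pform \<rho> \<phi>)"
| "fm_of_pform \<rho> (PAnd \<phi> \<psi>) = And (fm_of_pform \<rho> \<phi>) (fm_of_pform \<rho> \<psi>)"
| "fm_of_pform \<rho> (PEx x \<phi>) = E (fm_of_pform (\<lambda>y. if y = x then 0 else Suc (\<rho> y)) \<phi>)"

lemma Inum_num_of_pterm:
  assumes "\<And>x. x \<in> pvars t \<Longrightarrow> bs ! \<rho> x = v x"
  shows   "Inum bs (num_of_pterm \<rho> t) = peval v t"
  using assms by (induction t) auto

lemma Ifm_fm_of_pform:
  assumes "\<And>x. x \<in> pfree \<phi> \<Longrightarrow> bs ! \<rho> x = v x"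
  shows   "Ifm bbs bs (fm_of_pform \<rho> \<phi>) \<longleftrightarrow> psat v \<phi>"
  using assms
proof (induction \<phi> arbitrary: \<rho> bs v)
  case (PEq s t)
  thus ?case using Inum_num_of_pterm[of s bs \<rho> v] Inum_num_of_pterm[of t bs \<rho> v] by simp
next
  case (PLess s t)
  thus ?case using Inum_num_of_pterm[of s bs \<rho> v] Inum_num_of_pterm[of t bs \<rho> v] by simp
next
  case (PNot \<phi>)
  thus ?case by simp
next
  case (PAnd \<phi> \<psi>)
  thus ?case by simp
next
  case (PEx x \<phi>)
  have "Ifm bbs (k # bs) (fm_of_pform (\<lambda>y. if y = x then 0 else Suc (\<rho> y)) \<phi>)
          \<longleftrightarrow> psat (v(x := k)) \<phi>" for k
    using PEx.prems by (intro PEx.IH) auto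
  thus ?case by simp
qed

section \<open>Affine dependence of terms on the last variable\<close>

definition linform :: "nat \<Rightarrow> (nat \<Rightarrow> int) \<Rightarrow> int list \<Rightarrow> int" where
  "linform M b xs = (\<Sum>i<M. b i * xs ! i)"

lemma linform_add: "linform M (\<lambda>i. b i + b' i) xs = linform M b xs + linform M b' xs"
  by (simp add: linform_def sum.distrib algebra_simps)

lemma linform_cmult: "linform M (\<lambda>i. k * b i) xs = k * linform M b xs"
  by (simp add: linform_def sum_distrib_left mult.assoc)

lemma linform_uminus: "linform M (\<lambda>i. - b i) xs = - linform M b xs"
  using linform_cmult[of M "-1" b xs] by simp

lemma linform_diff: "linform M (\<lambda>i. b i - b' i) xs = linform M b xs - linform M b' xs"
  by (simp add: linform_def sum_subtractf algebra_simps)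

lemma linform_unit: "j < M \<Longrightarrow> linform M (\<lambda>i. if i = j then 1 else 0) xs = xs ! j"
  by (simp add: linform_def if_distrib[of "\<lambda>c. c * _"] cong: if_cong)

lemma linform_zero: "linform M (\<lambda>_. 0) xs = 0"
  by (simp add: linform_def)

text \<open>Each step of the recursion for \<open>!\<close> strips one element; what remains is an
  unspecified entry of \<open>[]\<close>, which depends on the list only through its length.\<close>

lemma nth_beyond_length: "length xs \<le> n \<Longrightarrow> xs ! n = [] ! (n - length xs)"
proof (induction xs arbitrary: n)
  case (Cons x xs)
  thus ?case by (cases n) auto
qed simp

text \<open>
  Indices beyond the length of the list are harmless: for lists of a fixed length
  they evaluate to a constant.
\<close>

lemma nth_snoc_affine:
  "\<exists>c b d. \<forall>xs y. length xs = M \<longrightarrow> (xs @ [y]) ! n = c * y + linform M b xs + d"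
proof -
  consider "n < M" | "n = M" | "n > M" by linarith
  thus ?thesis
  proof cases
    case 1
    thus ?thesis
      by (intro exI[of _ 0] exI[of _ "\<lambda>i. if i = n then 1 else 0"])
         (auto simp: linform_unit nth_append)
  next
    case 2
    thus ?thesis
      by (intro exI[of _ 1] exI[of _ "\<lambda>i. 0"] exI[of _ 0]) (auto simp: linform_zero)
  next
    case 3
    hence "(xs @ [y]) ! n = [] ! (n - Suc M)" if "length xs = M" for xs and y :: int
      using that nth_beyond_length[of "xs @ [y]" n] by simp
    thus ?thesis
      by (intro exI[of _ 0] exI[of _ "\<lambda>i. 0"] exI[of _ "[] ! (n - Suc M)"])
         (auto simp: linform_zero)
  qed
qed

text \<open>Induction on the term, since affine expressions are closed under all term constructors.
  The last entry \<open>y\<close> is kept apart because it stands for the function value.\<close>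

lemma Inum_snoc_affine:
  "\<exists>c b d. \<forall>xs y. length xs = M \<longrightarrow> Inum (xs @ [y]) t = c * y + linform M b xs + d"
proof (induction t)
  case (C k)
  show ?case by (intro exI[of _ 0] exI[of _ "\<lambda>i. 0"] exI[of _ k]) (auto simp: linform_zero)
next
  case (Bound n)
  show ?case using nth_snoc_affine[of M n] by simp
next
  case (CN n k t)
  obtain c b d where 1: "\<And>xs y. length xs = M \<Longrightarrow> (xs @ [y]) ! n = c * y + linform M b xs + d"
    using nth_snoc_affine[of M n] by blast
  from CN obtain c' b' d'
    where 2: "\<And>xs y. length xs = M \<Longrightarrow> Inum (xs @ [y]) t = c' * y + linform M b' xs + d'" by blast
  show ?case
    by (intro exI[of _ "k * c + c'"] exI[of _ "\<lambda>i. k * b i + b' i"] exI[of _ "k * d + d'"])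
       (auto simp: 1 2 linform_add linform_cmult algebra_simps)
next
  case (Neg t)
  then obtain c b d
    where 1: "\<And>xs y. length xs = M \<Longrightarrow> Inum (xs @ [y]) t = c * y + linform M b xs + d" by blast
  show ?case
    by (intro exI[of _ "-c"] exI[of _ "\<lambda>i. - b i"] exI[of _ "-d"]) (auto simp: 1 linform_uminus)
next
  case (Add s t)
  from Add.IH(1) obtain c b d
    where 1: "\<And>xs y. length xs = M \<Longrightarrow> Inum (xs @ [y]) s = c * y + linform M b xs + d" by blast
  from Add.IH(2) obtain c' b' d'
    where 2: "\<And>xs y. length xs = M \<Longrightarrow> Inum (xs @ [y]) t = c' * y + linform M b' xs + d'" by blast
  show ?case
    by (intro exI[of _ "c + c'"] exI[of _ "\<lambda>i. b i + b' i"] exI[of _ "d + d'"])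
       (auto simp: 1 2 linform_add algebra_simps)
next
  case (Sub s t)
  from Sub.IH(1) obtain c b d
    where 1: "\<And>xs y. length xs = M \<Longrightarrow> Inum (xs @ [y]) s = c * y + linform M b xs + d" by blast
  from Sub.IH(2) obtain c' b' d'
    where 2: "\<And>xs y. length xs = M \<Longrightarrow> Inum (xs @ [y]) t = c' * y + linform M b' xs + d'" by blast
  show ?case
    by (intro exI[of _ "c - c'"] exI[of _ "\<lambda>i. b i - b' i"] exI[of _ "d - d'"])
       (auto simp: 1 2 linform_diff algebra_simps)
next
  case (Mul k t)
  then obtain c b d
    where 1: "\<And>xs y. length xs = M \<Longrightarrow> Inum (xs @ [y]) t = c * y + linform M b xs + d" by blast
  show ?case
    by (intro exI[of _ "k * c"] exI[of _ "\<lambda>i. k * b i"] exI[of _ "k * d"])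
       (auto simp: 1 linform_cmult algebra_simps)
qed

section \<open>Periodicity in the last variable away from finitely many affine equations\<close>

type_synonym affine_eq = "int \<times> (nat \<Rightarrow> int) \<times> int"

text \<open>The condition \<open>c \<noteq> 0\<close> makes \<open>y\<close> determined by
  \<open>xs\<close>, so that each equation describes one affine piece.\<close>

definition solves :: "nat \<Rightarrow> int list \<Rightarrow> int \<Rightarrow> affine_eq \<Rightarrow> bool" where
  "solves M xs y = (\<lambda>(c, b, d). c \<noteq> 0 \<and> c * y = linform M b xs + d)"

text \<open>
  The truth value of a quantifier-free formula in its last variable \<open>y\<close> is periodic,
  except near the finitely many values of \<open>y\<close> at which some linear term changes sign.
\<close>

definition periodic_off :: "nat \<Rightarrow> int \<Rightarrow> affine_eq set \<Rightarrow> (int list \<Rightarrow> int \<Rightarrow> bool) \<Rightarrow> bool" where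
  "periodic_off M D S P \<longleftrightarrow> finite S \<and>
     (\<forall>xs y. length xs = M \<longrightarrow> P xs y \<noteq> P xs (y + D) \<longrightarrow> (\<exists>e\<in>S. solves M xs y e))"

definition piecewise_periodic :: "nat \<Rightarrow> (int list \<Rightarrow> int \<Rightarrow> bool) \<Rightarrow> bool" where
  "piecewise_periodic M P \<longleftrightarrow>
     (\<exists>D>0. \<forall>D'>0. D dvd D' \<longrightarrow> (\<exists>S. periodic_off M D' S P))"

text \<open>The product of the two periods serves both predicates. Where \<open>R\<close> changes,
  \<open>P\<close> or \<open>Q\<close> changes, so the union of the exceptional sets works.\<close>

lemma piecewise_periodic_combine:
  assumes "piecewise_periodic M P" "piecewise_periodic M Q"
    and "\<And>xs y. R xs y \<longleftrightarrow> h (P xs y) (Q xs y)"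
  shows   "piecewise_periodic M R"
proof -
  obtain D1 D2 where D: "D1 > 0" "D2 > 0"
     "\<And>D'. D' > 0 \<Longrightarrow> D1 dvd D' \<Longrightarrow> \<exists>S. periodic_off M D' S P"
     "\<And>D'. D' > 0 \<Longrightarrow> D2 dvd D' \<Longrightarrow> \<exists>S. periodic_off M D' S Q"
    using assms(1,2) unfolding piecewise_periodic_def by blast
  have "\<exists>S. periodic_off M D' S R" if D': "D' > 0" "D1 * D2 dvd D'" for D'
  proof -
    have "D1 dvd D'" "D2 dvd D'"
      using D'(2) dvd_mult_left dvd_mult_right by blast+
    then obtain S1 S2 where "periodic_off M D' S1 P" "periodic_off M D' S2 Q"
      using D D' by blast
    hence S: "finite S1" "finite S2"
      "\<And>xs y. length xs = M \<Longrightarrow> P xs y \<noteq> P xs (y + D') \<Longrightarrow> \<exists>e\<in>S1. solves M xs y e"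
      "\<And>xs y. length xs = M \<Longrightarrow> Q xs y \<noteq> Q xs (y + D') \<Longrightarrow> \<exists>e\<in>S2. solves M xs y e"
      unfolding periodic_off_def by blast+
    have "\<exists>e\<in>S1 \<union> S2. solves M xs y e" if "length xs = M" "R xs y \<noteq> R xs (y + D')" for xs y
    proof -
      have "P xs y \<noteq> P xs (y + D') \<or> Q xs y \<noteq> Q xs (y + D')"
        using that(2) unfolding assms(3) by (rule contrapos_np) simp
      thus ?thesis using S(3,4)[OF that(1)] by blast
    qed
    hence "periodic_off M D' (S1 \<union> S2) R"
      using S(1,2) unfolding periodic_off_def by blast
    thus ?thesis by blast
  qed
  thus ?thesis
    using D(1,2) unfolding piecewise_periodic_def by (intro exI[of _ "D1 * D2"]) auto
qed

lemma piecewise_periodic_not: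
  assumes "piecewise_periodic M P"
  shows   "piecewise_periodic M (\<lambda>xs y. \<not> P xs y)"
  using piecewise_periodic_combine[OF assms assms, of "\<lambda>xs y. \<not> P xs y" "\<lambda>P _. \<not> P"] by simp

lemma piecewise_periodic_const: "piecewise_periodic M (\<lambda>_ _. B)"
  unfolding piecewise_periodic_def periodic_off_def
  by (intro exI[of _ 1] conjI allI impI exI[of _ "{}"]) simp_all

text \<open>Adding \<open>w\<close> can change the sign of \<open>u\<close> only if the absolute
  value of \<open>u\<close> is at most that of \<open>w\<close>; here
  \<open>w = c * D\<close>.\<close>

lemma abs_le_of_sgn_change:
  fixes c y s D :: int
  assumes "sgn (c * y + s) \<noteq> sgn (c * (y + D) + s)" "D > 0"
  shows   "c \<noteq> 0" "\<bar>c * y + s\<bar> \<le> \<bar>c\<bar> * D"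
proof -
  show "c \<noteq> 0" using assms by auto
  have *: "\<bar>u\<bar> \<le> \<bar>w\<bar>" if "sgn u \<noteq> sgn (u + w)" for u w :: int
    using that by (auto simp: sgn_if split: if_splits)
  have "c * (y + D) + s = (c * y + s) + c * D" by (simp add: algebra_simps)
  with assms(1) have "\<bar>c * y + s\<bar> \<le> \<bar>c * D\<bar>" by (intro *) metis
  thus "\<bar>c * y + s\<bar> \<le> \<bar>c\<bar> * D" using assms(2) by (simp add: abs_mult)
qed

text \<open>A change of sign over a step \<open>D\<close> forces the term to have a value
  \<open>k\<close> of size at most \<open>\<bar>c\<bar> * D\<close>. These are finitely many
  integers, and each gives one affine equation for \<open>y\<close>.\<close>

lemma piecewise_periodic_sgn:
  "piecewise_periodic M (\<lambda>xs y. h (sgn (Inum (xs @ [y]) t)))"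
proof -
  obtain c b d
    where 1: "\<And>xs y. length xs = M \<Longrightarrow> Inum (xs @ [y]) t = c * y + linform M b xs + d"
    using Inum_snoc_affine[of M t] by blast
  have "\<exists>S. periodic_off M D S (\<lambda>xs y. h (sgn (Inum (xs @ [y]) t)))" if "D > 0" for D
  proof (intro exI)
    define S where "S = (\<lambda>k. (c, \<lambda>i. - b i, k - d)) ` {-\<bar>c\<bar>*D..\<bar>c\<bar>*D}"
    have "\<exists>e\<in>S. solves M xs y e"
      if "length xs = M" "h (sgn (Inum (xs @ [y]) t)) \<noteq> h (sgn (Inum (xs @ [y + D]) t))" for xs y
    proof -
      have "sgn (c * y + (linform M b xs + d)) \<noteq> sgn (c * (y + D) + (linform M b xs + d))"
        using that(2) unfolding 1[OF that(1)] add.assoc by metis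
      note * = abs_le_of_sgn_change[OF this \<open>D > 0\<close>]
      let ?k = "c * y + (linform M b xs + d)"
      have "solves M xs y (c, \<lambda>i. - b i, ?k - d)"
        using * by (simp add: solves_def linform_uminus)
      moreover have "(c, \<lambda>i. - b i, ?k - d) \<in> S"
        unfolding S_def using * by (intro imageI) auto
      ultimately show ?thesis by blast
    qed
    moreover have "finite S" by (simp add: S_def)
    ultimately show "periodic_off M D S (\<lambda>xs y. h (sgn (Inum (xs @ [y]) t)))"
      unfolding periodic_off_def by blast
  qed
  thus ?thesis unfolding piecewise_periodic_def by (meson zero_less_one)
qed

text \<open>For \<open>i \<noteq> 0\<close> divisibility by \<open>i\<close> has period
  \<open>\<bar>i\<bar>\<close> without exceptions; \<open>0 dvd t\<close> means
  \<open>t = 0\<close>, which is a condition on the sign.\<close>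

lemma piecewise_periodic_dvd:
  "piecewise_periodic M (\<lambda>xs y. i dvd Inum (xs @ [y]) t)"
proof (cases "i = 0")
  case True
  thus ?thesis
    using piecewise_periodic_sgn[of M "\<lambda>s. s = 0" t] by (simp add: sgn_0_0)
next
  case False
  obtain c b d
    where 1: "\<And>xs y. length xs = M \<Longrightarrow> Inum (xs @ [y]) t = c * y + linform M b xs + d"
    using Inum_snoc_affine[of M t] by blast
  have "periodic_off M D {} (\<lambda>xs y. i dvd Inum (xs @ [y]) t)" if "\<bar>i\<bar> dvd D" for D
    unfolding periodic_off_def
  proof (intro conjI allI impI)
    fix xs :: "int list" and y
    assume len: "length xs = M"
      and neq: "(i dvd Inum (xs @ [y]) t) \<noteq> (i dvd Inum (xs @ [y + D]) t)"
    have "Inum (xs @ [y + D]) t = Inum (xs @ [y]) t + c * D"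
      using len by (simp add: 1 algebra_simps)
    moreover have "i dvd c * D" using that by simp
    ultimately show "\<exists>e\<in>{}. solves M xs y e"
      using neq by (simp add: dvd_add_left_iff)
  qed simp
  thus ?thesis
    unfolding piecewise_periodic_def using False by (intro exI[of _ "\<bar>i\<bar>"]) auto
qed

lemma piecewise_periodic_qfree:
  "qfree p \<Longrightarrow> piecewise_periodic M (\<lambda>xs y. Ifm bbs (xs @ [y]) p)"
proof (induction p)
  case (Lt t)
  show ?case using piecewise_periodic_sgn[of M "\<lambda>s. s = -1" t] by (simp add: sgn_1_neg)
next
  case (Le t)
  show ?case using piecewise_periodic_sgn[of M "\<lambda>s. s \<noteq> 1" t] by (simp add: sgn_1_pos not_less)
next
  case (Gt t)
  show ?case using piecewise_periodic_sgn[of M "\<lambda>s. s = 1" t] by (simp add: sgn_1_pos)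
next
  case (Ge t)
  show ?case using piecewise_periodic_sgn[of M "\<lambda>s. s \<noteq> -1" t] by (simp add: sgn_1_neg not_less)
next
  case (Eq t)
  show ?case using piecewise_periodic_sgn[of M "\<lambda>s. s = 0" t] by (simp add: sgn_0_0)
next
  case (NEq t)
  show ?case using piecewise_periodic_sgn[of M "\<lambda>s. s \<noteq> 0" t] by (simp add: sgn_0_0)
next
  case (Dvd i t)
  show ?case using piecewise_periodic_dvd[of M i t] by simp
next
  case (NDvd i t)
  show ?case using piecewise_periodic_not[OF piecewise_periodic_dvd[of M i t]] by simp
next
  case (Not p)
  thus ?case using piecewise_periodic_not by simp
next
  case (And p q)
  thus ?case
    using piecewise_periodic_combine[of M "\<lambda>xs y. Ifm bbs (xs @ [y]) p"
            "\<lambda>xs y. Ifm bbs (xs @ [y]) q" "\<lambda>xs y. Ifm bbs (xs @ [y]) (And p q)" "\<lambda>P Q. P \<and> Q"] by simp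
next
  case (Or p q)
  thus ?case
    using piecewise_periodic_combine[of M "\<lambda>xs y. Ifm bbs (xs @ [y]) p"
            "\<lambda>xs y. Ifm bbs (xs @ [y]) q" "\<lambda>xs y. Ifm bbs (xs @ [y]) (Or p q)" "\<lambda>P Q. P \<or> Q"] by simp
next
  case (Imp p q)
  thus ?case
    using piecewise_periodic_combine[of M "\<lambda>xs y. Ifm bbs (xs @ [y]) p"
            "\<lambda>xs y. Ifm bbs (xs @ [y]) q" "\<lambda>xs y. Ifm bbs (xs @ [y]) (Imp p q)" "\<lambda>P Q. P \<longrightarrow> Q"] by simp
next
  case (Iff p q)
  thus ?case
    using piecewise_periodic_combine[of M "\<lambda>xs y. Ifm bbs (xs @ [y]) p"
            "\<lambda>xs y. Ifm bbs (xs @ [y]) q" "\<lambda>xs y. Ifm bbs (xs @ [y]) (Iff p q)" "\<lambda>P Q. P = Q"] by simp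
qed (simp_all add: piecewise_periodic_const)

text \<open>After quantifier elimination the graph is given by a formula that holds at
  \<open>y = f xs\<close> and fails at \<open>f xs + D\<close> with \<open>D > 0\<close>. So its
  truth value changes at \<open>f xs\<close>, which must therefore solve one of the exceptional
  equations.\<close>

theorem presburger_definable_fun_piecewise_affine:
  assumes "presburger_definable_fun M f"
  obtains S where "finite S" "\<And>xs. length xs = M \<Longrightarrow> \<exists>e\<in>S. solves M xs (f xs) e"
proof -
  from assms obtain \<phi> where \<phi>: "pfree \<phi> \<subseteq> {..<Suc M}"
    "{xs @ [f xs] | xs. xs \<in> ivecs M UNIV} = {xs \<in> ivecs (Suc M) UNIV. psat (pvaluation xs) \<phi>}"
    unfolding presburger_definable_fun_def presburger_definable_def by blast
  define p where "p = pa (fm_of_pform (\<lambda>x. x) \<phi>)"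
  have p: "Ifm [] (xs @ [y]) p \<longleftrightarrow> y = f xs" if "length xs = M" for xs y
  proof -
    have "Ifm [] (xs @ [y]) p \<longleftrightarrow> psat (pvaluation (xs @ [y])) \<phi>"
      unfolding p_def mirqe[THEN conjunct1] using that \<phi>(1)
      by (intro Ifm_fm_of_pform) (auto simp: pvaluation_def)
    also have "\<dots> \<longleftrightarrow> xs @ [y] \<in> {xs @ [f xs] | xs. xs \<in> ivecs M UNIV}"
      unfolding \<phi>(2) using that by (simp add: ivecs_def)
    also have "\<dots> \<longleftrightarrow> y = f xs" using that by (auto simp: ivecs_def)
    finally show ?thesis .
  qed
  have "qfree p" unfolding p_def using mirqe by blast
  from piecewise_periodic_qfree[OF this, of M "[]"] obtain D S
    where "D > 0" "periodic_off M D S (\<lambda>xs y. Ifm [] (xs @ [y]) p)"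
    unfolding piecewise_periodic_def by (metis dvd_refl)
  hence DS: "finite S" "D > 0" "\<And>xs y. length xs = M \<Longrightarrow>
     Ifm [] (xs @ [y]) p \<noteq> Ifm [] (xs @ [y + D]) p \<Longrightarrow> \<exists>e\<in>S. solves M xs y e"
    unfolding periodic_off_def by auto
  show ?thesis
    using DS by (intro that[of S]) (auto simp: p)
qed

hide_const (open) T F E C A

section \<open>Dirichlet convolution and factorials\<close>

text \<open>Writing \<open>n = d * k\<close> matches the pairs of \<open>n \<le> X\<close> and a
  divisor \<open>d\<close> with the pairs \<open>(d, k)\<close> such that
  \<open>d * k \<le> X\<close>.\<close>

lemma sum_dvd_swap:
  fixes g :: "nat \<Rightarrow> nat \<Rightarrow> 'a :: comm_monoid_add"
  shows "(\<Sum>n=1..X. \<Sum>d | d dvd n. g d (n div d)) = (\<Sum>d=1..X. \<Sum>k=1..X div d. g d k)"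
proof -
  have "(\<Sum>n=1..X. \<Sum>d | d dvd n. g d (n div d)) =
          (\<Sum>(n,d)\<in>(SIGMA n:{1..X}. {d. d dvd n}). g d (n div d))"
    by (rule sum.Sigma) auto
  also have "\<dots> = (\<Sum>(d,k)\<in>(SIGMA d:{1..X}. {1..X div d}). g d k)"
  proof (rule sum.reindex_bij_witness[of _ "\<lambda>(d,k). (d * k, d)" "\<lambda>(n,d). (d, n div d)"], goal_cases)
    case (2 a)
    then obtain n d where a: "a = (n, d)" "1 \<le> n" "n \<le> X" "d dvd n" by auto
    hence "d > 0" "d \<le> n" by (auto intro!: Nat.gr0I dvd_imp_le)
    with a show ?case by (auto simp: div_le_mono elim!: dvdE)
  next
    case (4 b)
    then obtain d k where b: "b = (d, k)" "1 \<le> d" "1 \<le> k" "k \<le> X div d" by auto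
    hence "d * k \<le> X"
      by (metis le_trans mult_le_mono2 times_div_less_eq_dividend)
    with b show ?case by auto
  qed auto
  also have "\<dots> = (\<Sum>d=1..X. \<Sum>k=1..X div d. g d k)"
    by (rule sum.Sigma [symmetric]) auto
  finally show ?thesis .
qed

lemma ln_fact_eq_sum: "ln (fact n :: real) = (\<Sum>k=1..n. ln (real k))"
  by (induction n) (auto simp: ln_mult)

text \<open>A weak Stirling bound; the induction step rests on
  \<open>n * ln (1 + 1 / n) \<le> 1\<close>.\<close>

lemma ln_fact_ge: "real n * ln (real n) - real n \<le> ln (fact n)"
proof (induction n)
  case (Suc n)
  show ?case
  proof (cases "n = 0")
    case False
    have "ln (real (Suc n)) - ln (real n) = ln (real (Suc n) / real n)"
      using False by (simp add: ln_div)
    also have "real (Suc n) / real n = 1 + 1 / real n" using False by (simp add: field_simps)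
    finally have "real n * (ln (real (Suc n)) - ln (real n)) = real n * ln (1 + 1 / real n)"
      by simp
    also have "\<dots> \<le> real n * (1 / real n)"
      using False by (intro mult_left_mono ln_add_one_self_le_self) auto
    also have "\<dots> = 1" using False by simp
    finally have "real n * ln (real (Suc n)) \<le> real n * ln (real n) + 1"
      by (simp add: algebra_simps)
    moreover have "ln (fact (Suc n) :: real) = ln (real (Suc n)) + ln (fact n)"
      by (simp add: ln_mult)
    moreover have "real (Suc n) * ln (real (Suc n)) - real (Suc n) =
        real n * ln (real (Suc n)) + ln (real (Suc n)) - real n - 1"
      by (simp add: algebra_simps)
    ultimately show ?thesis using Suc.IH by linarith
  qed auto
qed auto

lemma ln_fact_le: "ln (fact n) \<le> real n * ln (real n)"
proof -
  have "(\<Sum>k=1..n. ln (real k)) \<le> (\<Sum>k=1..n. ln (real n))"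
    by (intro sum_mono) auto
  thus ?thesis by (simp add: ln_fact_eq_sum)
qed

text \<open>Legendre's formula in logarithmic form: \<open>ln n\<close> is the sum of
  \<open>mangoldt d\<close> over \<open>d dvd n\<close>, and \<open>X div d\<close> counts the
  multiples of \<open>d\<close> up to \<open>X\<close>.\<close>

lemma ln_fact_eq_sum_mangoldt:
  "ln (fact X) = (\<Sum>d=1..X. mangoldt d * real (X div d))"
proof -
  have "ln (fact X) = (\<Sum>n=1..X. ln (real n))" by (rule ln_fact_eq_sum)
  also have "\<dots> = (\<Sum>n=1..X. \<Sum>d | d dvd n. mangoldt d)"
    by (intro sum.cong refl) (simp add: mangoldt_sum)
  also have "\<dots> = (\<Sum>d=1..X. \<Sum>k=1..X div d. mangoldt d)"
    by (rule sum_dvd_swap[of "\<lambda>d _. mangoldt d"])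
  finally show ?thesis by (simp add: mult.commute)
qed

section \<open>Chebyshev's and Mertens' estimates\<close>

definition chebyshev_psi :: "nat \<Rightarrow> real" where
  "chebyshev_psi X = (\<Sum>n=1..X. mangoldt n)"

text \<open>Chebyshev's argument: the logarithm of \<open>2 * k choose k\<close> is a sum of
  \<open>mangoldt d\<close> with the coefficients \<open>2 * k div d - 2 * (k div d)\<close>, which
  are never negative and are at least 1 for \<open>k < d \<le> 2 * k\<close>.\<close>

lemma chebyshev_psi_double: "chebyshev_psi (2 * k) \<le> chebyshev_psi k + 2 * real k * ln 2"
proof -
  have split: "(\<Sum>d=1..2*k. h d) = (\<Sum>d=1..k. h d) + (\<Sum>d=k+1..2*k. h d)" for h :: "nat \<Rightarrow> real"
    using sum.ub_add_nat[of 1 k h k] by (simp add: mult_2)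
  have "chebyshev_psi (2 * k) - chebyshev_psi k = (\<Sum>d=k+1..2*k. mangoldt d)"
    unfolding chebyshev_psi_def by (subst split) simp
  also have "\<dots> \<le> (\<Sum>d=k+1..2*k. mangoldt d * (real (2 * k div d) - 2 * real (k div d)))"
  proof (intro sum_mono)
    fix d assume d: "d \<in> {k+1..2*k}"
    hence "2 * k div d \<ge> 1" by (simp add: Suc_le_eq div_greater_zero_iff)
    hence "mangoldt d * 1 \<le> mangoldt d * real (2 * k div d)"
      by (intro mult_left_mono) (auto simp: mangoldt_nonneg)
    thus "mangoldt d \<le> mangoldt d * (real (2 * k div d) - 2 * real (k div d))"
      using d by simp
  qed
  also have "\<dots> \<le> (\<Sum>d=1..2*k. mangoldt d * (real (2 * k div d) - 2 * real (k div d)))"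
  proof (intro sum_mono2)
    fix d
    have "2 * (k div d) \<le> 2 * k div d"
      by (cases "d = 0") (auto simp: less_eq_div_iff_mult_less_eq algebra_simps)
    hence "2 * real (k div d) \<le> real (2 * k div d)" by linarith
    thus "mangoldt d * (real (2 * k div d) - 2 * real (k div d)) \<ge> 0"
      by (simp add: mangoldt_nonneg)
  qed auto
  also have "\<dots> = ln (fact (2 * k)) - 2 * (\<Sum>d=1..2*k. mangoldt d * real (k div d))"
    by (simp add: ln_fact_eq_sum_mangoldt algebra_simps sum_subtractf sum_distrib_left)
  also have "(\<Sum>d=1..2*k. mangoldt d * real (k div d)) = ln (fact k)"
    by (subst split) (simp add: ln_fact_eq_sum_mangoldt)
  also have "ln (fact (2 * k)) - 2 * ln (fact k) = ln (real (2 * k choose k))"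
    by (simp add: binomial_fact ln_div ln_mult mult_2 [of k])
  also have "\<dots> \<le> ln (2 ^ (2 * k))"
  proof (subst ln_le_cancel_iff)
    have "2 * k choose k \<le> 2 ^ (2 * k)" by (rule binomial_le_pow2)
    thus "real (2 * k choose k) \<le> 2 ^ (2 * k)"
      by (metis of_nat_le_iff of_nat_numeral of_nat_power)
  qed auto
  also have "\<dots> = 2 * real k * ln 2" by (simp add: ln_realpow)
  finally show ?thesis by simp
qed

text \<open>Induction by halving: \<open>ln 2 \<le> 1\<close> turns the bound \<open>4 * k\<close>
  into \<open>6 * k\<close> at \<open>2 * k\<close>, and an odd \<open>X\<close> adds at most
  \<open>ln X \<le> 2 * k\<close>.\<close>

lemma chebyshev_psi_le: "chebyshev_psi X \<le> 4 * real X"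
proof (induction X rule: less_induct)
  case (less X)
  show ?case
  proof (cases "X \<le> 1")
    case True
    hence "X = 0 \<or> X = 1" by auto
    thus ?thesis by (auto simp: chebyshev_psi_def)
  next
    case False
    define k where "k = X div 2"
    have k: "k < X" "k \<ge> 1" using False by (auto simp: k_def)
    have ln2: "ln 2 \<le> (1 :: real)" using ln_le_minus_one[of 2] by simp
    have *: "chebyshev_psi (2 * k) \<le> 6 * real k"
    proof -
      have "2 * real k * ln 2 \<le> 2 * real k * 1" using ln2 by (intro mult_left_mono) auto
      thus ?thesis using chebyshev_psi_double[of k] less.IH[OF k(1)] by simp
    qed
    show ?thesis
    proof (cases "even X")
      case True
      thus ?thesis using * by (auto simp: k_def elim!: evenE)
    next
      case False
      hence X: "X = Suc (2 * k)" by (auto simp: k_def elim!: oddE)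
      have "mangoldt X \<le> ln (real X)" using k by (intro mangoldt_le) auto
      also have "\<dots> \<le> 2 * real k" using ln_le_minus_one[of "real X"] X by simp
      finally have "chebyshev_psi X \<le> 8 * real k" using * by (simp add: X chebyshev_psi_def)
      thus ?thesis using X by simp
    qed
  qed
qed

text \<open>Replacing \<open>X / n\<close> by \<open>X div n + 1\<close> gives
  \<open>ln (fact X)\<close> plus an error of \<open>chebyshev_psi X \<le> 4 * X\<close>.\<close>

lemma sum_mangoldt_over_le:
  assumes "X > 0"
  shows   "(\<Sum>n=1..X. mangoldt n / real n) \<le> ln (real X) + 4"
proof -
  have "real X * (\<Sum>n=1..X. mangoldt n / real n) = (\<Sum>n=1..X. mangoldt n * (real X / real n))"
    by (simp add: sum_distrib_left mult_ac)
  also have "\<dots> \<le> (\<Sum>n=1..X. mangoldt n * (real (X div n) + 1))"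
  proof (intro sum_mono mult_left_mono)
    fix n assume n: "n \<in> {1..X}"
    have "X < n * (X div n + 1)"
      using n by (simp add: dividend_less_times_div)
    hence "real X \<le> real n * (real (X div n) + 1)"
      by (metis of_nat_1 of_nat_add of_nat_le_iff of_nat_mult less_imp_le)
    thus "real X / real n \<le> real (X div n) + 1"
      using n by (simp add: divide_le_eq mult.commute)
  qed (auto simp: mangoldt_nonneg)
  also have "\<dots> = ln (fact X) + chebyshev_psi X"
    by (simp add: ln_fact_eq_sum_mangoldt chebyshev_psi_def algebra_simps sum.distrib)
  also have "\<dots> \<le> real X * (ln (real X) + 4)"
    using ln_fact_le[of X] chebyshev_psi_le[of X] by (simp add: algebra_simps)
  finally show ?thesis using assms by simp
qed

lemma sum_mangoldt_over_ge:
  assumes "X > 0"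
  shows   "(\<Sum>n=1..X. mangoldt n / real n) \<ge> ln (real X) - 1"
proof -
  have "real X * (ln (real X) - 1) \<le> ln (fact X)"
    using ln_fact_ge[of X] by (simp add: algebra_simps)
  also have "\<dots> = (\<Sum>d=1..X. mangoldt d * real (X div d))"
    by (rule ln_fact_eq_sum_mangoldt)
  also have "\<dots> \<le> (\<Sum>d=1..X. mangoldt d * (real X / real d))"
    by (intro sum_mono mult_left_mono of_nat_div_le_of_nat) (auto simp: mangoldt_nonneg)
  also have "\<dots> = real X * (\<Sum>n=1..X. mangoldt n / real n)"
    by (simp add: sum_distrib_left mult_ac)
  finally show ?thesis using assms by simp
qed

section \<open>The Moebius function\<close>

definition mobius :: "nat \<Rightarrow> real" where
  "mobius n = (if squarefree n then (-1) ^ card (prime_factors n) else 0)"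

lemma abs_mobius_le: "\<bar>mobius n\<bar> \<le> 1"
  by (simp add: mobius_def)

lemma mobius_1 [simp]: "mobius (Suc 0) = 1"
  by (simp add: mobius_def)

lemma mobius_prime_mult:
  assumes "prime p" "\<not> p dvd d" "d > 0"
  shows   "mobius (p * d) = - mobius d"
proof -
  have "coprime p d" using assms by (simp add: prime_imp_coprime)
  hence "squarefree (p * d) \<longleftrightarrow> squarefree d"
    using assms(1) squarefree_mult_coprime[of p d] squarefree_multD(2)[of p d] squarefree_prime
    by blast
  moreover have "prime_factors (p * d) = insert p (prime_factors d)"
    using assms by (subst prime_factors_product) (auto simp: prime_factorization_prime)
  moreover have "p \<notin> prime_factors d" using assms by auto
  ultimately show ?thesis by (simp add: mobius_def)
qed

text \<open>Fix a prime \<open>p\<close> dividing \<open>n\<close>. The squarefree divisors come in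
  pairs \<open>d\<close>, \<open>p * d\<close> with \<open>p\<close> not dividing \<open>d\<close>,
  and the two values in a pair cancel.\<close>

lemma sum_mobius_dvd:
  assumes "n > 0"
  shows   "(\<Sum>d | d dvd n. mobius d) = (if n = 1 then 1 else 0)"
proof (cases "n = 1")
  case False
  then obtain p where p: "prime p" "p dvd n" using prime_factor_nat by blast
  define A where "A = {d. d dvd n \<and> squarefree d \<and> \<not> p dvd d}"
  have fin: "finite {d. d dvd n}" using assms by simp
  have pos: "d > 0" if "d dvd n" for d using that assms by (auto intro!: Nat.gr0I)
  have "(\<Sum>d | d dvd n. mobius d) = (\<Sum>d\<in>A \<union> (*) p ` A. mobius d)"
  proof (rule sum.mono_neutral_right)
    show "A \<union> (*) p ` A \<subseteq> {d. d dvd n}"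
      using p by (auto simp: A_def intro!: divides_mult prime_imp_coprime)
    show "\<forall>i\<in>{d. d dvd n} - (A \<union> (*) p ` A). mobius i = 0"
    proof
      fix d assume d: "d \<in> {d. d dvd n} - (A \<union> (*) p ` A)"
      have "\<not> squarefree d"
      proof
        assume sf: "squarefree d"
        with d have "p dvd d" by (auto simp: A_def)
        then obtain e where e: "d = p * e" by blast
        have "\<not> p dvd e" using sf p(1) unfolding e
          by (metis dvdE mult.assoc not_prime_unit power2_eq_square squarefreeD dvd_triv_left)
        moreover have "squarefree e" using sf e squarefree_multD(2) by blast
        moreover have "e dvd n" using d e by (metis DiffD1 dvd_mult_right mem_Collect_eq)
        ultimately have "e \<in> A" by (simp add: A_def)
        thus False using d e by auto
      qed
      thus "mobius d = 0" by (simp add: mobius_def)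
    qed
  qed (rule fin)
  also have "\<dots> = (\<Sum>d\<in>A. mobius d) + (\<Sum>d\<in>(*) p ` A. mobius d)"
  proof (rule sum.union_disjoint)
    show "finite A" by (rule finite_subset[OF _ fin]) (auto simp: A_def)
    thus "finite ((*) p ` A)" by simp
  qed (auto simp: A_def)
  also have "(\<Sum>d\<in>(*) p ` A. mobius d) = (\<Sum>d\<in>A. mobius (p * d))"
    using p by (subst sum.reindex) (auto simp: inj_on_def prime_gt_0_nat)
  also have "\<dots> = (\<Sum>d\<in>A. - mobius d)"
    using p(1) pos by (intro sum.cong refl mobius_prime_mult) (auto simp: A_def)
  finally show ?thesis using False by (simp add: sum_negf)
qed simp

text \<open>Moebius inversion: expand \<open>ln (n div d)\<close> into values of
  \<open>mangoldt\<close> and swap the sums; the inner Moebius sum over the divisors of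
  \<open>n div e\<close> leaves only \<open>e = n\<close>.\<close>

lemma sum_mobius_ln_dvd:
  assumes "n > 0"
  shows   "(\<Sum>d | d dvd n. mobius d * ln (real (n div d))) = mangoldt n"
proof -
  have divs: "{e. e dvd n div d} = {e. e \<in> {e. e dvd n} \<and> d * e dvd n}" if "d dvd n" for d
  proof -
    have "d \<noteq> 0" using that assms by auto
    hence "e dvd n div d \<longleftrightarrow> d * e dvd n" for e
      using that by (simp add: dvd_div_iff_mult mult.commute)
    thus ?thesis using dvd_mult_right by blast
  qed
  have "(\<Sum>d | d dvd n. mobius d * ln (real (n div d))) =
          (\<Sum>d | d dvd n. \<Sum>e | e dvd n div d. mobius d * mangoldt e)"
  proof (intro sum.cong refl)
    fix d assume "d \<in> {d. d dvd n}"
    hence "n div d \<noteq> 0" using assms by auto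
    thus "mobius d * ln (real (n div d)) = (\<Sum>e | e dvd n div d. mobius d * mangoldt e)"
      by (simp add: mangoldt_sum sum_distrib_left [symmetric])
  qed
  also have "\<dots> = (\<Sum>d | d dvd n. \<Sum>e | e \<in> {e. e dvd n} \<and> d * e dvd n. mobius d * mangoldt e)"
    by (intro sum.cong refl divs) auto
  also have "\<dots> = (\<Sum>e | e dvd n. \<Sum>d | d \<in> {d. d dvd n} \<and> d * e dvd n. mobius d * mangoldt e)"
    using assms by (intro sum.swap_restrict) auto
  also have "\<dots> = (\<Sum>e | e dvd n. \<Sum>d | d dvd n div e. mobius d * mangoldt e)"
    by (intro sum.cong refl) (auto simp: divs mult.commute)
  also have "\<dots> = (\<Sum>e | e dvd n. if e = n then mangoldt e else 0)"
  proof (intro sum.cong refl)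
    fix e assume e: "e \<in> {e. e dvd n}"
    hence "n div e > 0" using assms by (auto intro!: Nat.gr0I)
    hence "(\<Sum>d | d dvd n div e. mobius d * mangoldt e) = (if n div e = 1 then 1 else 0) * mangoldt e"
      by (simp only: sum_mobius_dvd sum_distrib_right [symmetric])
    also have "n div e = 1 \<longleftrightarrow> e = n" using e assms by auto
    finally show "(\<Sum>d | d dvd n div e. mobius d * mangoldt e) = (if e = n then mangoldt e else 0)"
      by simp
  qed
  also have "\<dots> = mangoldt n" using assms by simp
  finally show ?thesis .
qed

section \<open>Characters with bounded partial sums\<close>

text \<open>The function \<open>ln x / x\<close> decreases from \<open>exp 1\<close> on, and 3 is
  the first integer beyond that point.\<close>

lemma ln_over_antimono:
  fixes m n :: nat
  assumes "3 \<le> m" "m \<le> n"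
  shows   "ln (real n) / real n \<le> ln (real m) / real m"
proof -
  have "exp 1 \<le> real m" using exp_le assms by linarith
  hence ln_m: "ln (real m) \<ge> 1" using assms by (subst ln_ge_iff) auto
  have "ln (real n / real m) \<le> real n / real m - 1" using assms by (intro ln_le_minus_one) auto
  hence "ln (real n) \<le> ln (real m) + (real n / real m - 1) * 1"
    using assms by (simp add: ln_div)
  also have "\<dots> \<le> ln (real m) + (real n / real m - 1) * ln (real m)"
    using ln_m assms by (intro add_left_mono mult_left_mono) auto
  finally show ?thesis using assms by (simp add: field_simps)
qed

text \<open>Abstracts a nontrivial Dirichlet character; the bound on the partial sums is what rules
  out the trivial one.\<close>

locale bounded_character =
  fixes \<chi> :: "nat \<Rightarrow> complex" and B :: real
  assumes mult: "\<chi> (m * n) = \<chi> m * \<chi> n"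
    and one: "\<chi> 1 = 1"
    and norm_le: "norm (\<chi> n) \<le> 1"
    and partial_sums: "norm (\<Sum>n=a..b. \<chi> n) \<le> B"
begin

lemma B_nonneg: "B \<ge> 0"
  using partial_sums[of 1 0] by simp

text \<open>Summation by parts: the partial sums are bounded by \<open>B\<close>, and the decrements
  of the weight telescope.\<close>

lemma abel_bound:
  fixes g :: "nat \<Rightarrow> real"
  assumes antimono: "\<And>m n. a \<le> m \<Longrightarrow> m \<le> n \<Longrightarrow> g n \<le> g m"
    and nonneg: "\<And>n. a \<le> n \<Longrightarrow> g n \<ge> 0"
  shows "norm (\<Sum>n=a..b. \<chi> n * of_real (g n)) \<le> B * g a"
proof (cases "a \<le> b")
  case False
  thus ?thesis using B_nonneg nonneg[of a] by simp
next
  case True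
  define P where "P n = (\<Sum>k=a..n. \<chi> k)" for n
  have "(\<Sum>n=a..b. \<chi> n * of_real (g n)) =
          P b * of_real (g b) + (\<Sum>n=a..<b. P n * of_real (g n - g (Suc n)))"
    using True
  proof (induction rule: dec_induct)
    case base
    thus ?case by (simp add: P_def)
  next
    case (step n)
    have "P (Suc n) = P n + \<chi> (Suc n)" using step.hyps by (simp add: P_def)
    thus ?case using step by (simp add: algebra_simps)
  qed
  also have "norm \<dots> \<le> B * g b + (\<Sum>n=a..<b. B * (g n - g (Suc n)))"
  proof (intro norm_triangle_mono sum_norm_le)
    show "norm (P b * of_real (g b)) \<le> B * g b"
      unfolding P_def norm_mult norm_of_real using nonneg[of b] True partial_sums B_nonneg
      by (intro mult_mono) auto
    fix n assume "n \<in> {a..<b}"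
    hence "g (Suc n) \<le> g n" by (intro antimono) auto
    thus "norm (P n * of_real (g n - g (Suc n))) \<le> B * (g n - g (Suc n))"
      unfolding P_def norm_mult norm_of_real using partial_sums B_nonneg
      by (intro mult_mono) auto
  qed
  also have "(\<Sum>n=a..<b. B * (g n - g (Suc n))) = B * (g a - g b)"
    using sum_Suc_diff'[OF True, of "\<lambda>n. - g n"] by (simp flip: sum_distrib_left)
  finally show ?thesis by (simp add: algebra_simps)
qed

text \<open>The value at 1 of the L-series of \<open>\<chi>\<close>. The term at
  \<open>n = 0\<close> is a division by zero and hence 0.\<close>

definition L1 :: complex where "L1 = (\<Sum>n. \<chi> n / of_nat n)"

definition L1_partial :: "nat \<Rightarrow> complex" where "L1_partial y = (\<Sum>n=1..y. \<chi> n / of_nat n)"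

definition mangoldt_sum_over :: "nat \<Rightarrow> complex" where
  "mangoldt_sum_over X = (\<Sum>n=1..X. \<chi> n * of_real (mangoldt n / real n))"

lemma L1_block_bound:
  assumes "a > 0"
  shows   "norm (\<Sum>n=a..b. \<chi> n / of_nat n) \<le> B / real a"
  using abel_bound[of a "\<lambda>n. 1 / real n" b] assms by (simp add: field_simps)

lemma summable_L1: "summable (\<lambda>n. \<chi> n / of_nat n)"
  unfolding summable_Cauchy
proof (intro allI impI)
  fix e :: real assume e: "e > 0"
  obtain N :: nat where N: "real N > B / e" using reals_Archimedean2 by blast
  show "\<exists>N. \<forall>m\<ge>N. \<forall>n. norm (\<Sum>n=m..<n. \<chi> n / of_nat n) < e"
  proof (intro exI[of _ "Suc N"] allI impI)
    fix m n assume m: "m \<ge> Suc N"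
    have "norm (\<Sum>n=m..<n. \<chi> n / of_nat n) \<le> B / real m"
    proof (cases n)
      case 0
      thus ?thesis using B_nonneg by simp
    next
      case (Suc k)
      thus ?thesis using L1_block_bound[of m k] m by (simp add: atLeastLessThanSuc_atLeastAtMost)
    qed
    also have "B / real m < e"
    proof -
      have "B / e < real m" using N m by linarith
      thus ?thesis using e m by (simp add: field_simps)
    qed
    finally show "norm (\<Sum>n=m..<n. \<chi> n / of_nat n) < e" .
  qed
qed

text \<open>Let \<open>N\<close> tend to infinity in the bound for the block from
  \<open>y + 1\<close> to \<open>N\<close>.\<close>

lemma L1_partial_bound: "norm (L1 - L1_partial y) \<le> B / real (Suc y)"
proof -
  have eq: "(\<Sum>n<Suc N. \<chi> n / of_nat n) = L1_partial N" for N
    unfolding L1_partial_def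
    by (rule sum.mono_neutral_right) (auto simp: not_le)
  have "(\<lambda>N. \<Sum>n<Suc N. \<chi> n / of_nat n) \<longlonglongrightarrow> L1"
    unfolding L1_def using summable_LIMSEQ[OF summable_L1] by (rule LIMSEQ_Suc)
  hence "(\<lambda>N. L1_partial N - L1_partial y) \<longlonglongrightarrow> L1 - L1_partial y"
    unfolding eq by (intro tendsto_diff tendsto_const)
  moreover have "\<forall>\<^sub>F N in sequentially. norm (L1_partial N - L1_partial y) \<le> B / real (Suc y)"
    using eventually_ge_at_top[of y]
  proof eventually_elim
    case (elim N)
    hence "L1_partial N = L1_partial y + (\<Sum>n=Suc y..N. \<chi> n / of_nat n)"
      unfolding L1_partial_def using sum.ub_add_nat[of 1 y "\<lambda>n. \<chi> n / of_nat n" "N - y"] by simp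
    thus ?case using L1_block_bound[of "Suc y" N] by simp
  qed
  ultimately show ?thesis
    using tendsto_upperbound[OF tendsto_norm] by (metis sequentially_bot)
qed

text \<open>The weight \<open>ln n / n\<close> decreases only from 3 on; the terms at 1 and 2 are
  bounded by 1 each, which gives the summand 2.\<close>

lemma ln_sum_bound: "norm (\<Sum>n=1..X. \<chi> n * of_real (ln (real n) / real n)) \<le> B + 2"
proof -
  let ?f = "\<lambda>n. \<chi> n * of_real (ln (real n) / real n) :: complex"
  have le1: "norm (?f n) \<le> 1" for n
  proof -
    have "norm (?f n) \<le> 1 * 1"
      unfolding norm_mult norm_of_real
    proof (intro mult_mono norm_le)
      have "ln (real n) \<le> real n" if "n > 0" using ln_le_minus_one[of "real n"] that by simp
      thus "\<bar>ln (real n) / real n\<bar> \<le> 1" by (cases "n = 0") auto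
    qed auto
    thus ?thesis by simp
  qed
  have "{1..X} = ({1..2} \<inter> {1..X}) \<union> {3..X}" by auto
  also have "sum ?f \<dots> = sum ?f ({1..2} \<inter> {1..X}) + sum ?f {3..X}"
    by (rule sum.union_disjoint) auto
  also have "norm \<dots> \<le> 2 + B"
  proof (rule norm_triangle_mono)
    have "norm (sum ?f ({1..2} \<inter> {1..X})) \<le> (\<Sum>n\<in>{1..2} \<inter> {1..X}. 1)"
      by (intro sum_norm_le le1)
    also have "\<dots> \<le> (\<Sum>n\<in>{1..2::nat}. 1)" by (intro sum_mono2) auto
    finally show "norm (sum ?f ({1..2} \<inter> {1..X})) \<le> 2" by simp
    have "norm (sum ?f {3..X}) \<le> B * (ln (real 3) / real 3)"
      by (intro abel_bound ln_over_antimono) auto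
    also have "\<dots> \<le> B * 1"
      using ln_le_minus_one[of 3] by (intro mult_left_mono B_nonneg) auto
    finally show "norm (sum ?f {3..X}) \<le> B" by simp
  qed
  finally show ?thesis by simp
qed

text \<open>Expanding \<open>ln n\<close> over divisors turns the bounded sum of
  \<open>\<chi> n * ln n / n\<close> into a sum of \<open>\<chi> d * mangoldt d / d\<close> times
  \<open>L1_partial (X div d)\<close>. Replacing the partial sums by \<open>L1\<close> costs
  \<open>mangoldt d * B / X\<close> for each \<open>d\<close>, at most \<open>4 * B\<close> in total
  by Chebyshev's bound.\<close>

lemma L1_times_mangoldt_sum_over_bound:
  assumes "X > 0"
  shows   "norm (L1 * mangoldt_sum_over X) \<le> 5 * B + 2"
proof -
  let ?c = "\<lambda>d. \<chi> d * of_real (mangoldt d / real d) :: complex"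
  have "(\<Sum>n=1..X. \<chi> n * of_real (ln (real n) / real n)) =
          (\<Sum>n=1..X. \<Sum>d | d dvd n. ?c d * (\<chi> (n div d) / of_nat (n div d)))"
  proof (intro sum.cong refl)
    fix n assume n: "n \<in> {1..X}"
    have "\<chi> n * of_real (ln (real n) / real n) = \<chi> n * of_real (\<Sum>d | d dvd n. mangoldt d) / of_nat n"
      using n by (simp add: mangoldt_sum)
    also have "\<dots> = (\<Sum>d | d dvd n. \<chi> n * of_real (mangoldt d) / of_nat n)"
      by (simp add: sum_distrib_left sum_divide_distrib)
    also have "\<dots> = (\<Sum>d | d dvd n. ?c d * (\<chi> (n div d) / of_nat (n div d)))"
    proof (intro sum.cong refl)
      fix d assume "d \<in> {d. d dvd n}"
      then obtain k where k: "n = d * k" by auto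
      hence "d > 0" "k > 0" using n by auto
      thus "\<chi> n * of_real (mangoldt d) / of_nat n = ?c d * (\<chi> (n div d) / of_nat (n div d))"
        by (simp add: k mult)
    qed
    finally show "\<chi> n * of_real (ln (real n) / real n) =
        (\<Sum>d | d dvd n. ?c d * (\<chi> (n div d) / of_nat (n div d)))" .
  qed
  also have "\<dots> = (\<Sum>d=1..X. ?c d * L1_partial (X div d))"
    unfolding L1_partial_def by (subst sum_dvd_swap) (simp add: sum_distrib_left)
  finally have "L1 * mangoldt_sum_over X =
      (\<Sum>n=1..X. \<chi> n * of_real (ln (real n) / real n)) +
      (\<Sum>d=1..X. ?c d * (L1 - L1_partial (X div d)))"
    unfolding mangoldt_sum_over_def right_diff_distrib sum_subtractf
    by (simp only: sum_distrib_left mult.commute[of L1] diff_add_eq_diff_diff_swap) simp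
  also have "norm \<dots> \<le> (B + 2) + (\<Sum>d=1..X. mangoldt d * (B / real X))"
  proof (intro norm_triangle_mono ln_sum_bound sum_norm_le)
    fix d assume d: "d \<in> {1..X}"
    have "norm (?c d * (L1 - L1_partial (X div d))) \<le> (1 * (mangoldt d / real d)) * (B / real (Suc (X div d)))"
      unfolding norm_mult norm_of_real using norm_le mangoldt_nonneg[of d] L1_partial_bound
      by (intro mult_mono) (auto intro!: divide_nonneg_nonneg)
    also have "\<dots> = mangoldt d * (B / (real d * real (Suc (X div d))))" by simp
    also have "\<dots> \<le> mangoldt d * (B / real X)"
    proof (intro mult_left_mono divide_left_mono mangoldt_nonneg B_nonneg mult_pos_pos)
      have "X \<le> d * Suc (X div d)"
        using d dividend_less_times_div[of d X] by simp
      thus "real X \<le> real d * real (Suc (X div d))" by (metis of_nat_le_iff of_nat_mult)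
    qed (use d assms in auto)
    finally show "norm (?c d * (L1 - L1_partial (X div d))) \<le> mangoldt d * (B / real X)" .
  qed
  also have "(\<Sum>d=1..X. mangoldt d * (B / real X)) = chebyshev_psi X * (B / real X)"
    by (simp only: chebyshev_psi_def sum_distrib_right)
  also have "\<dots> \<le> (4 * real X) * (B / real X)"
    by (intro mult_right_mono chebyshev_psi_le) (auto intro: divide_nonneg_nonneg B_nonneg)
  also have "\<dots> = 4 * B" using assms by simp
  finally show ?thesis by simp
qed

lemma mangoldt_sum_over_bound:
  assumes "L1 \<noteq> 0" "X > 0"
  shows   "norm (mangoldt_sum_over X) \<le> (5 * B + 2) / norm L1"
  using L1_times_mangoldt_sum_over_bound[of X] assms by (simp add: norm_mult field_simps)

text \<open>The sum of \<open>mobius d * ln (X / d)\<close> over \<open>d dvd n\<close> is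
  \<open>mangoldt n\<close>, plus \<open>ln X\<close> at \<open>n = 1\<close>. Hence the left side
  is a sum over \<open>d\<close> with factors \<open>L1_partial (X div d)\<close>. As
  \<open>L1 = 0\<close>, these are at most \<open>B * d / X\<close>, and the sum of
  \<open>ln (X / d)\<close> is at most \<open>X\<close> by the Stirling bound.\<close>

lemma mangoldt_sum_over_if_L1_0:
  assumes "L1 = 0" "X > 0"
  shows   "norm (of_real (ln (real X)) + mangoldt_sum_over X) \<le> B"
proof -
  let ?c = "\<lambda>d. \<chi> d * of_real (mobius d * ln (real X / real d) / real d) :: complex"
  have sum1: "(\<Sum>d | d dvd n. mobius d * ln (real X / real d)) =
                (if n = 1 then ln (real X) else 0) + mangoldt n" if n: "n > 0" for n
  proof -
    have "(\<Sum>d | d dvd n. mobius d * ln (real X / real d)) =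
          (\<Sum>d | d dvd n. mobius d * ln (real X / real n) + mobius d * ln (real (n div d)))"
    proof (intro sum.cong refl)
      fix d assume "d \<in> {d. d dvd n}"
      then obtain k where k: "n = d * k" by auto
      hence "d > 0" "k > 0" using n by auto
      thus "mobius d * ln (real X / real d) =
              mobius d * ln (real X / real n) + mobius d * ln (real (n div d))"
        using assms by (simp add: k ln_div ln_mult algebra_simps)
    qed
    also have "\<dots> = (if n = 1 then 1 else 0) * ln (real X / real n) + mangoldt n"
      using n by (simp only: sum.distrib sum_mobius_ln_dvd sum_distrib_right [symmetric] sum_mobius_dvd)
    also have "\<dots> = (if n = 1 then ln (real X) else 0) + mangoldt n" by simp
    finally show ?thesis .
  qed
  have "of_real (ln (real X)) + mangoldt_sum_over X =
          (\<Sum>n=1..X. (if n = 1 then of_real (ln (real X)) else 0) + \<chi> n * of_real (mangoldt n / real n))"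
    using assms one by (simp add: mangoldt_sum_over_def sum.distrib)
  also have "\<dots> = (\<Sum>n=1..X. \<Sum>d | d dvd n. ?c d * (\<chi> (n div d) / of_nat (n div d)))"
  proof (intro sum.cong refl)
    fix n assume n: "n \<in> {1..X}"
    have "(if n = 1 then of_real (ln (real X)) else 0) + \<chi> n * of_real (mangoldt n / real n) =
          \<chi> n * of_real ((if n = 1 then ln (real X) else 0) + mangoldt n) / of_nat n"
      using one by simp
    also have "\<dots> = \<chi> n * of_real (\<Sum>d | d dvd n. mobius d * ln (real X / real d)) / of_nat n"
      using n by (subst sum1) auto
    also have "\<dots> = (\<Sum>d | d dvd n. \<chi> n * of_real (mobius d * ln (real X / real d)) / of_nat n)"
      by (simp add: sum_distrib_left sum_divide_distrib)
    also have "\<dots> = (\<Sum>d | d dvd n. ?c d * (\<chi> (n div d) / of_nat (n div d)))"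
    proof (intro sum.cong refl)
      fix d assume "d \<in> {d. d dvd n}"
      then obtain k where k: "n = d * k" by auto
      hence "d > 0" "k > 0" using n by auto
      thus "\<chi> n * of_real (mobius d * ln (real X / real d)) / of_nat n =
              ?c d * (\<chi> (n div d) / of_nat (n div d))"
        by (simp add: k mult)
    qed
    finally show "(if n = 1 then of_real (ln (real X)) else 0) + \<chi> n * of_real (mangoldt n / real n) =
        (\<Sum>d | d dvd n. ?c d * (\<chi> (n div d) / of_nat (n div d)))" .
  qed
  also have "\<dots> = (\<Sum>d=1..X. ?c d * L1_partial (X div d))"
    unfolding L1_partial_def by (subst sum_dvd_swap) (simp add: sum_distrib_left)
  also have "norm \<dots> \<le> (\<Sum>d=1..X. ln (real X / real d) * (B / real X))"
  proof (intro sum_norm_le)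
    fix d assume d: "d \<in> {1..X}"
    have ln: "ln (real X / real d) \<ge> 0" using d by simp
    have abs: "\<bar>mobius d * ln (real X / real d) / real d\<bar> \<le> ln (real X / real d) / real d"
    proof -
      have "\<bar>mobius d\<bar> * ln (real X / real d) \<le> 1 * ln (real X / real d)"
        by (intro mult_right_mono abs_mobius_le ln)
      thus ?thesis using ln d by (simp add: abs_mult divide_right_mono)
    qed
    have "norm (L1_partial (X div d)) \<le> B / real (Suc (X div d))"
      using L1_partial_bound[of "X div d"] assms by simp
    hence "norm (?c d * L1_partial (X div d)) \<le>
            (1 * (ln (real X / real d) / real d)) * (B / real (Suc (X div d)))"
      unfolding norm_mult norm_of_real using norm_le abs ln
      by (intro mult_mono) (auto intro!: divide_nonneg_nonneg)
    also have "\<dots> = ln (real X / real d) * (B / (real d * real (Suc (X div d))))" by simp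
    also have "\<dots> \<le> ln (real X / real d) * (B / real X)"
    proof (intro mult_left_mono divide_left_mono ln B_nonneg mult_pos_pos)
      have "X \<le> d * Suc (X div d)"
        using d dividend_less_times_div[of d X] by simp
      thus "real X \<le> real d * real (Suc (X div d))" by (metis of_nat_le_iff of_nat_mult)
    qed (use d assms in auto)
    finally show "norm (?c d * L1_partial (X div d)) \<le> ln (real X / real d) * (B / real X)" .
  qed
  also have "\<dots> = (\<Sum>d=1..X. ln (real X) - ln (real d)) * (B / real X)"
    unfolding sum_distrib_right using assms by (intro sum.cong refl) (auto simp: ln_div)
  also have "(\<Sum>d=1..X. ln (real X) - ln (real d)) = real X * ln (real X) - ln (fact X)"
    by (simp add: sum_subtractf ln_fact_eq_sum)
  also have "(real X * ln (real X) - ln (fact X)) * (B / real X) \<le> real X * (B / real X)"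
    using ln_fact_ge[of X] by (intro mult_right_mono) (auto intro: divide_nonneg_nonneg B_nonneg)
  also have "\<dots> = B" using assms by simp
  finally show ?thesis .
qed

end

section \<open>Characters modulo an integer with a primitive root\<close>

text \<open>Full periods cancel, so a sum starting at 0 reduces to fewer than \<open>m\<close>
  terms; a general block is a difference of two such sums.\<close>

lemma sum_periodic_bound:
  fixes f :: "nat \<Rightarrow> complex"
  assumes per: "\<And>n. f (n + m) = f n" and zero: "(\<Sum>n<m. f n) = 0"
    and bound: "\<And>n. norm (f n) \<le> 1" and "m > 0"
  shows   "norm (\<Sum>n=a..b. f n) \<le> 2 * real m"
proof -
  have per': "f (n + q * m) = f n" for n q
  proof (induction q)
    case (Suc q)
    have "f (n + Suc q * m) = f ((n + q * m) + m)" by (simp add: algebra_simps)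
    thus ?case using Suc per by simp
  qed simp
  have blocks: "(\<Sum>n<q * m. f n) = 0" for q
  proof (induction q)
    case (Suc q)
    have "(\<Sum>n<Suc q * m. f n) = (\<Sum>n<q * m. f n) + (\<Sum>n=0 + q * m..<m + q * m. f n)"
      using sum.atLeastLessThan_concat[of 0 "q * m" "Suc q * m" f] by (simp add: lessThan_atLeast0)
    also have "(\<Sum>n=0 + q * m..<m + q * m. f n) = (\<Sum>n<m. f n)"
      unfolding sum.shift_bounds_nat_ivl by (simp add: per' lessThan_atLeast0)
    finally show ?case using Suc zero by simp
  qed simp
  have init: "norm (\<Sum>n<b. f n) \<le> real m" for b
  proof -
    have "sum f {..<b} = sum f {..<b div m * m} + sum f {b div m * m..<b}"
      using sum.atLeastLessThan_concat[of 0 "b div m * m" b f] by (simp add: lessThan_atLeast0)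
    also have "\<dots> = sum f {b div m * m..<b}" by (simp add: blocks)
    also have "norm \<dots> \<le> (\<Sum>n\<in>{b div m * m..<b}. 1)" by (intro sum_norm_le bound)
    also have "\<dots> = real (b mod m)" by (simp add: minus_div_mult_eq_mod)
    also have "\<dots> \<le> real m" using assms(4) by simp
    finally show ?thesis .
  qed
  show ?thesis
  proof (cases "a \<le> b")
    case True
    hence "sum f {..<Suc b} = sum f {..<a} + sum f {a..b}"
      using sum.atLeastLessThan_concat[of 0 a "Suc b" f]
      by (simp add: lessThan_atLeast0 atLeastLessThanSuc_atLeastAtMost)
    hence "sum f {a..b} = sum f {..<Suc b} - sum f {..<a}" by simp
    also have "norm \<dots> \<le> real m + real m"
      by (intro order_trans[OF norm_triangle_ineq4] add_mono init)
    finally show ?thesis by simp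
  qed auto
qed

locale primroot =
  fixes m g :: nat
  assumes m_gt_1: "m > 1" and primroot: "residue_primroot m g"
begin

definition N :: nat where "N = totient m"

definition \<omega> :: complex where "\<omega> = cis (2 * pi / real N)"

text \<open>The discrete logarithm to base \<open>g\<close>. For \<open>n\<close> coprime to
  \<open>m\<close> it is determined modulo \<open>N\<close>, just as exponents of
  \<open>\<omega>\<close> are.\<close>

definition ind :: "nat \<Rightarrow> nat" where "ind n = (SOME i. [g ^ i = n] (mod m))"

text \<open>As the unit group is cyclic, the indices \<open>k < N\<close> give all Dirichlet
  characters modulo \<open>m\<close>; index 0 is the principal one.\<close>

definition dchar :: "nat \<Rightarrow> nat \<Rightarrow> complex" where
  "dchar k n = (if coprime n m then \<omega> ^ (k * ind n) else 0)"

lemma coprime_g: "coprime m g"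
  using primroot by (simp add: residue_primroot_def)

lemma ord_g: "ord m g = N"
  using primroot by (simp add: residue_primroot_def N_def)

lemma N_pos: "N > 0"
  using m_gt_1 by (simp add: N_def)

lemma power_g_cong_iff: "[g ^ i = g ^ j] (mod m) \<longleftrightarrow> [i = j] (mod N)"
  using order_divides_expdiff[OF coprime_g] by (simp add: ord_g)

lemma ind_cong: "[n = n'] (mod m) \<Longrightarrow> ind n = ind n'"
  by (simp add: ind_def cong_def)

lemma power_ind:
  assumes "coprime n m"
  shows   "[g ^ ind n = n] (mod m)"
proof -
  have "n mod m \<in> totatives m"
    using assms m_gt_1 by (auto simp: in_totatives_iff intro!: Nat.gr0I less_imp_le)
  then obtain i where "n mod m = g ^ i mod m"
    using bij_betw_imp_surj_on[OF residue_primroot_is_generator[OF m_gt_1 primroot]] by force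
  hence "[g ^ i = n] (mod m)" by (simp add: cong_def)
  thus ?thesis unfolding ind_def by (rule someI)
qed

lemma norm_\<omega> [simp]: "norm \<omega> = 1"
  by (simp add: \<omega>_def)

lemma \<omega>_power_N: "\<omega> ^ N = 1"
  using N_pos by (simp add: \<omega>_def DeMoivre)

lemma \<omega>_power_mod: "\<omega> ^ (i mod N) = \<omega> ^ i"
proof -
  have "\<omega> ^ i = \<omega> ^ (N * (i div N) + i mod N)" by simp
  also have "\<dots> = \<omega> ^ (i mod N)" unfolding power_add power_mult by (simp add: \<omega>_power_N)
  finally show ?thesis ..
qed

lemma \<omega>_power_cong: "[i = j] (mod N) \<Longrightarrow> \<omega> ^ i = \<omega> ^ j"
  unfolding cong_def by (metis \<omega>_power_mod)

lemma \<omega>_power_eq_1_iff: "\<omega> ^ i = 1 \<longleftrightarrow> N dvd i"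
proof
  assume "\<omega> ^ i = 1"
  hence "\<omega> ^ (i mod N) = 1" by (simp add: \<omega>_power_mod)
  hence "cis (2 * pi * real (i mod N) / real N) = cis (2 * pi * real 0 / real N)"
    by (simp add: \<omega>_def DeMoivre mult_ac)
  moreover have "inj_on (\<lambda>k. cis (2 * pi * real k / real N)) {..<N}"
    using bij_betw_roots_unity[OF N_pos] bij_betw_def by blast
  ultimately have "i mod N = 0"
    using N_pos by (elim inj_onD) auto
  thus "N dvd i" by auto
qed (auto simp: power_mult \<omega>_power_N elim!: dvdE)

lemma sum_\<omega>_power: "(\<Sum>k<N. \<omega> ^ (k * i)) = (if N dvd i then of_nat N else 0)"
proof (cases "N dvd i")
  case True
  thus ?thesis by (simp add: \<omega>_power_eq_1_iff[THEN iffD2])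
next
  case False
  have "(\<Sum>k<N. \<omega> ^ (k * i)) = (\<Sum>k<N. (\<omega> ^ i) ^ k)"
    by (simp add: power_mult [symmetric] mult.commute)
  also have "\<dots> = ((\<omega> ^ i) ^ N - 1) / (\<omega> ^ i - 1)"
    using False by (intro geometric_sum) (simp add: \<omega>_power_eq_1_iff)
  also have "(\<omega> ^ i) ^ N = (\<omega> ^ N) ^ i" by (simp add: power_mult [symmetric] mult.commute)
  finally show ?thesis using False by (simp add: \<omega>_power_N)
qed

text \<open>Orthogonality over the characters: a geometric sum in \<open>\<omega> ^ ind n\<close>,
  where \<open>N dvd ind n\<close> says that \<open>n\<close> is 1 modulo \<open>m\<close>.\<close>

lemma sum_dchar:
  "(\<Sum>k<N. dchar k n) = (if [n = 1] (mod m) then of_nat N else 0)"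
proof (cases "coprime n m")
  case False
  hence "\<not> [n = 1] (mod m)" by (metis cong_imp_coprime cong_sym coprime_1_left)
  with False show ?thesis by (simp add: dchar_def)
next
  case True
  have "N dvd ind n \<longleftrightarrow> [g ^ ind n = 1] (mod m)"
    by (simp only: ord_divides ord_g)
  also have "\<dots> \<longleftrightarrow> [n = 1] (mod m)"
    using power_ind[OF True] by (meson cong_sym cong_trans)
  finally show ?thesis using True sum_\<omega>_power[of "ind n"] by (simp add: dchar_def)
qed

lemma dchar_power_g: "dchar k (g ^ i mod m) = \<omega> ^ (k * i)"
proof -
  have cop: "coprime (g ^ i mod m) m"
    using coprime_g m_gt_1 by (simp add: coprime_commute)
  have "[g ^ ind (g ^ i mod m) = g ^ i] (mod m)"
    using power_ind[OF cop] by (simp add: cong_def)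
  hence "[ind (g ^ i mod m) = i] (mod N)" by (simp add: power_g_cong_iff)
  hence "\<omega> ^ (k * ind (g ^ i mod m)) = \<omega> ^ (k * i)"
    by (intro \<omega>_power_cong cong_scalar_left)
  thus ?thesis using cop by (simp add: dchar_def)
qed

lemma dchar_period: "dchar k (n + m) = dchar k n"
proof -
  have "ind (n + m) = ind n" by (rule ind_cong) (simp add: cong_def)
  moreover have "coprime (n + m) m \<longleftrightarrow> coprime n m"
    by (simp only: coprime_iff_gcd_eq_1 gcd_add1)
  ultimately show ?thesis by (simp add: dchar_def)
qed

lemma norm_dchar_le: "norm (dchar k n) \<le> 1"
  by (simp add: dchar_def norm_power)

text \<open>Orthogonality over the residues: the powers of \<open>g\<close> run through the units,
  so this is again a geometric sum.\<close>

lemma sum_dchar_period: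
  assumes "0 < k" "k < N"
  shows   "(\<Sum>n<m. dchar k n) = 0"
proof -
  have "(\<Sum>n<m. dchar k n) = (\<Sum>n\<in>totatives m. dchar k n)"
  proof (rule sum.mono_neutral_right)
    show "totatives m \<subseteq> {..<m}"
      using m_gt_1 by (auto simp: totatives_def intro!: le_neq_implies_less)
    show "\<forall>i\<in>{..<m} - totatives m. dchar k i = 0"
      using m_gt_1 by (auto simp: totatives_def dchar_def intro!: Nat.gr0I)
  qed auto
  also have "\<dots> = (\<Sum>i<N. dchar k (g ^ i mod m))"
    using residue_primroot_is_generator[OF m_gt_1 primroot]
    unfolding N_def by (intro sum.reindex_bij_betw [symmetric])
  also have "\<dots> = (\<Sum>i<N. \<omega> ^ (i * k))" by (simp add: dchar_power_g mult.commute)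
  also have "\<dots> = 0" using assms by (auto simp: sum_\<omega>_power dest: dvd_imp_le)
  finally show ?thesis .
qed

lemma dchar_mult: "dchar k (a * b) = dchar k a * dchar k b"
proof (cases "coprime a m \<and> coprime b m")
  case True
  have "[g ^ ind (a * b) = g ^ (ind a + ind b)] (mod m)"
  proof -
    have "[g ^ ind (a * b) = a * b] (mod m)" using True by (intro power_ind) auto
    moreover have "[g ^ ind a * g ^ ind b = a * b] (mod m)"
      using True by (intro cong_mult power_ind) auto
    ultimately show ?thesis unfolding power_add by (meson cong_sym cong_trans)
  qed
  hence "[k * ind (a * b) = k * (ind a + ind b)] (mod N)"
    by (intro cong_scalar_left) (simp add: power_g_cong_iff)
  hence "\<omega> ^ (k * ind (a * b)) = \<omega> ^ (k * (ind a + ind b))" by (rule \<omega>_power_cong)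
  thus ?thesis using True by (simp add: dchar_def power_add algebra_simps)
qed (auto simp: dchar_def)

lemma dchar_1: "dchar k 1 = 1"
  using dchar_power_g[of k 0] m_gt_1 by simp

lemma bounded_character_dchar:
  assumes "0 < k" "k < N"
  shows   "bounded_character (dchar k) (2 * real m)"
proof
  show "norm (\<Sum>n=a..b. dchar k n) \<le> 2 * real m" for a b
    using m_gt_1 sum_dchar_period[OF assms] norm_dchar_le dchar_period
    by (intro sum_periodic_bound) auto
qed (simp_all only: dchar_mult dchar_1 norm_dchar_le)

text \<open>On units the values at \<open>k\<close> and \<open>N - k\<close> multiply to 1 and have
  modulus 1. This yields the pairing of zeros of the L-values.\<close>

lemma dchar_cnj:
  assumes "k < N"
  shows   "dchar (N - k) n = cnj (dchar k n)"
proof (cases "coprime n m")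
  case True
  have "\<omega> ^ ((N - k) * ind n) * \<omega> ^ (k * ind n) = \<omega> ^ (N * ind n)"
    using assms by (simp add: power_add [symmetric] add_mult_distrib [symmetric])
  also have "\<dots> = 1" by (simp add: power_mult \<omega>_power_N)
  finally have *: "\<omega> ^ ((N - k) * ind n) * \<omega> ^ (k * ind n) = 1" .
  have **: "\<omega> ^ (k * ind n) * cnj (\<omega> ^ (k * ind n)) = 1"
    by (subst complex_norm_square [symmetric]) (simp add: norm_power)
  have "\<omega> ^ ((N - k) * ind n) = \<omega> ^ ((N - k) * ind n) * (\<omega> ^ (k * ind n) * cnj (\<omega> ^ (k * ind n)))"
    unfolding ** by simp
  also have "\<dots> = cnj (\<omega> ^ (k * ind n))" using * by (simp add: mult.assoc [symmetric])
  finally show ?thesis using True by (simp add: dchar_def)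
qed (simp add: dchar_def)

abbreviation dL1 :: "nat \<Rightarrow> complex" where "dL1 k \<equiv> bounded_character.L1 (dchar k)"

abbreviation dS :: "nat \<Rightarrow> nat \<Rightarrow> complex" where
  "dS k \<equiv> bounded_character.mangoldt_sum_over (dchar k)"

lemma dL1_cnj:
  assumes "0 < k" "k < N"
  shows   "dL1 (N - k) = cnj (dL1 k)"
proof -
  interpret k: bounded_character "dchar k" "2 * real m" by (rule bounded_character_dchar[OF assms])
  interpret k': bounded_character "dchar (N - k)" "2 * real m"
    using assms by (intro bounded_character_dchar) auto
  have "(\<lambda>n. \<Sum>i<n. dchar k i / of_nat i) \<longlonglongrightarrow> k.L1"
    unfolding k.L1_def using k.summable_L1 by (rule summable_LIMSEQ)
  hence "(\<lambda>n. cnj (\<Sum>i<n. dchar k i / of_nat i)) \<longlonglongrightarrow> cnj k.L1"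
    by (rule tendsto_cnj)
  hence "(\<lambda>n. (\<Sum>i<n. dchar (N - k) i / of_nat i)) \<longlonglongrightarrow> cnj k.L1"
    using assms by (simp add: dchar_cnj)
  moreover have "(\<lambda>n. (\<Sum>i<n. dchar (N - k) i / of_nat i)) \<longlonglongrightarrow> k'.L1"
    unfolding k'.L1_def using k'.summable_L1 by (rule summable_LIMSEQ)
  ultimately show ?thesis using LIMSEQ_unique by blast
qed

section \<open>Mertens sums over numbers congruent to 1, and the nonvanishing of L-values\<close>

definition mangoldt_sum_1 :: "nat \<Rightarrow> real" where
  "mangoldt_sum_1 X = (\<Sum>n | n \<in> {1..X} \<and> [n = 1] (mod m). mangoldt n / real n)"

definition mangoldt_sum_coprime :: "nat \<Rightarrow> real" where
  "mangoldt_sum_coprime X = (\<Sum>n | n \<in> {1..X} \<and> coprime n m. mangoldt n / real n)"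

text \<open>Orthogonality detects the residue 1. Index 0 contributes the sum over numbers coprime to
  \<open>m\<close>, and real parts suffice because the left side is real.\<close>

lemma mangoldt_sum_1_decomp:
  "real N * mangoldt_sum_1 X = mangoldt_sum_coprime X + (\<Sum>k\<in>{0<..<N}. Re (dS k X))"
proof -
  have "complex_of_real (real N * mangoldt_sum_1 X) =
          (\<Sum>n=1..X. (if [n = 1] (mod m) then of_nat N else 0) * of_real (mangoldt n / real n))"
    unfolding mangoldt_sum_1_def
    by (subst sum.inter_filter) (auto simp: sum_distrib_left intro!: sum.cong)
  also have "\<dots> = (\<Sum>n=1..X. \<Sum>k<N. dchar k n * of_real (mangoldt n / real n))"
    by (simp only: sum_dchar [symmetric] sum_distrib_right)
  also have "\<dots> = (\<Sum>k<N. \<Sum>n=1..X. dchar k n * of_real (mangoldt n / real n))"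
    by (rule sum.swap)
  also have "{..<N} = insert 0 {0<..<N}" using N_pos by auto
  also have "(\<Sum>k\<in>\<dots>. \<Sum>n=1..X. dchar k n * of_real (mangoldt n / real n)) =
     (\<Sum>n=1..X. dchar 0 n * of_real (mangoldt n / real n)) +
     (\<Sum>k\<in>{0<..<N}. \<Sum>n=1..X. dchar k n * of_real (mangoldt n / real n))"
    by (subst sum.insert) auto
  also have "(\<Sum>n=1..X. dchar 0 n * of_real (mangoldt n / real n)) = of_real (mangoldt_sum_coprime X)"
    unfolding mangoldt_sum_coprime_def
    by (subst sum.inter_filter) (auto simp: dchar_def intro!: sum.cong)
  also have "(\<Sum>k\<in>{0<..<N}. \<Sum>n=1..X. dchar k n * of_real (mangoldt n / real n)) = (\<Sum>k\<in>{0<..<N}. dS k X)"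
    by (intro sum.cong refl bounded_character.mangoldt_sum_over_def
          [OF bounded_character_dchar, symmetric]) auto
  finally have "Re (complex_of_real (real N * mangoldt_sum_1 X)) =
      Re (complex_of_real (mangoldt_sum_coprime X) + (\<Sum>k\<in>{0<..<N}. dS k X))" by simp
  thus ?thesis by simp
qed

lemma mangoldt_sum_1_nonneg: "mangoldt_sum_1 X \<ge> 0"
  unfolding mangoldt_sum_1_def by (intro sum_nonneg divide_nonneg_nonneg mangoldt_nonneg) auto

lemma mangoldt_sum_coprime_le:
  assumes "X > 0"
  shows   "mangoldt_sum_coprime X \<le> ln (real X) + 4"
proof -
  have "mangoldt_sum_coprime X \<le> (\<Sum>n=1..X. mangoldt n / real n)"
    unfolding mangoldt_sum_coprime_def
    by (intro sum_mono2) (auto intro!: divide_nonneg_nonneg mangoldt_nonneg)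
  thus ?thesis using sum_mangoldt_over_le[OF assms] by linarith
qed

text \<open>Puts both cases in one form: the sum is bounded if the L-value is nonzero, and otherwise
  stays within a constant of \<open>- ln X\<close>.\<close>

lemma dS_bound:
  assumes "0 < k" "k < N"
  obtains C where "C \<ge> 0"
    "\<And>X. X > 0 \<Longrightarrow> \<bar>Re (dS k X) + (if dL1 k = 0 then ln (real X) else 0)\<bar> \<le> C"
proof -
  interpret bounded_character "dchar k" "2 * real m" by (rule bounded_character_dchar[OF assms])
  show ?thesis
  proof (cases "L1 = 0")
    case True
    have "\<bar>Re (dS k X) + ln (real X)\<bar> \<le> 2 * real m" if "X > 0" for X
      using order_trans[OF abs_Re_le_cmod mangoldt_sum_over_if_L1_0[OF True that]]
      by (simp add: add.commute)
    thus ?thesis using True by (intro that[of "2 * real m"]) auto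
  next
    case False
    have "\<bar>Re (dS k X)\<bar> \<le> (5 * (2 * real m) + 2) / norm L1" if "X > 0" for X
      using order_trans[OF abs_Re_le_cmod mangoldt_sum_over_bound[OF False that]] .
    thus ?thesis using False by (intro that[of "(5 * (2 * real m) + 2) / norm L1"]) auto
  qed
qed

text \<open>
  A zero of \<open>L(1, \<chi>)\<close> contributes \<open>- ln X\<close>, the trivial character only \<open>ln X\<close>, and the total
  is nonnegative: so at most one \<open>L(1, \<chi>)\<close> vanishes. As zeros come in conjugate pairs,
  the vanishing one must be real.
\<close>

lemma dL1_eq_0_unique:
  assumes "0 < k" "k < N" "dL1 k = 0"
  shows   "2 * k = N"
proof (rule ccontr)
  assume neq: "2 * k \<noteq> N"
  define k' where "k' = N - k"
  have k': "0 < k'" "k' < N" "k' \<noteq> k" "dL1 k' = 0"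
    using assms neq dL1_cnj[of k] by (auto simp: k'_def)
  have "\<exists>C. \<forall>i\<in>{0<..<N}. C i \<ge> 0 \<and>
     (\<forall>X>0. \<bar>Re (dS i X) + (if dL1 i = 0 then ln (real X) else 0)\<bar> \<le> C i)"
    by (intro bchoice ballI) (metis dS_bound greaterThanLessThan_iff)
  then obtain C where C: "\<And>i. i \<in> {0<..<N} \<Longrightarrow> C i \<ge> 0"
    "\<And>i X. i \<in> {0<..<N} \<Longrightarrow> X > 0 \<Longrightarrow>
       \<bar>Re (dS i X) + (if dL1 i = 0 then ln (real X) else 0)\<bar> \<le> C i" by blast
  have "ln (real X) \<le> 4 + (\<Sum>i\<in>{0<..<N}. C i)" if X: "X > 0" for X
  proof -
    have "0 \<le> real N * mangoldt_sum_1 X" by (simp add: mangoldt_sum_1_nonneg)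
    also have "\<dots> \<le> (ln (real X) + 4) + (\<Sum>i\<in>{0<..<N}. C i - (if i \<in> {k, k'} then ln (real X) else 0))"
      unfolding mangoldt_sum_1_decomp
    proof (intro add_mono sum_mono mangoldt_sum_coprime_le X)
      fix i assume i: "i \<in> {0<..<N}"
      have "ln (real X) \<ge> 0" using X by simp
      thus "Re (dS i X) \<le> C i - (if i \<in> {k, k'} then ln (real X) else 0)"
        using C(2)[OF i X] assms(3) k'(4) by (auto split: if_splits)
    qed
    also have "(\<Sum>i\<in>{0<..<N}. C i - (if i \<in> {k, k'} then ln (real X) else 0)) =
       (\<Sum>i\<in>{0<..<N}. C i) - (\<Sum>i\<in>{0<..<N} \<inter> {k, k'}. ln (real X))"
      by (simp only: sum_subtractf sum.inter_restrict finite_greaterThanLessThan)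
    also have "{0<..<N} \<inter> {k, k'} = {k, k'}" using assms k' by auto
    finally show ?thesis using k'(3) by simp
  qed
  moreover obtain X :: nat where "real X > exp (4 + (\<Sum>i\<in>{0<..<N}. C i))"
    using reals_Archimedean2 by blast
  moreover from this have "X > 0" by (metis exp_gt_zero less_trans of_nat_0_less_iff)
  ultimately show False
    by (metis exp_gt_zero less_trans linorder_not_le ln_exp ln_less_cancel_iff)
qed

text \<open>Only the index \<open>N / 2\<close> could have a vanishing L-value. With this excluded,
  all nonprincipal sums are bounded and go into the constant.\<close>

lemma mangoldt_sum_1_ge:
  assumes "\<And>k. 2 * k = N \<Longrightarrow> dL1 k \<noteq> 0"
  obtains C where "\<And>X. X > 0 \<Longrightarrow> real N * mangoldt_sum_1 X \<ge> mangoldt_sum_coprime X - C"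
proof -
  have nz: "dL1 k \<noteq> 0" if "k \<in> {0<..<N}" for k
    using that assms dL1_eq_0_unique by auto
  have "\<exists>C. \<forall>i\<in>{0<..<N}. \<forall>X>0. \<bar>Re (dS i X)\<bar> \<le> C i"
  proof (intro bchoice ballI)
    fix i assume i: "i \<in> {0<..<N}"
    then obtain C where "\<And>X. X > 0 \<Longrightarrow> \<bar>Re (dS i X) + (if dL1 i = 0 then ln (real X) else 0)\<bar> \<le> C"
      using dS_bound[of i] by auto
    thus "\<exists>C. \<forall>X>0. \<bar>Re (dS i X)\<bar> \<le> C" using nz[OF i] by auto
  qed
  then obtain C where C: "\<And>i X. i \<in> {0<..<N} \<Longrightarrow> X > 0 \<Longrightarrow> \<bar>Re (dS i X)\<bar> \<le> C i" by blast
  have "real N * mangoldt_sum_1 X \<ge> mangoldt_sum_coprime X - (\<Sum>i\<in>{0<..<N}. C i)" if X: "X > 0" for X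
  proof -
    have "(\<Sum>i\<in>{0<..<N}. - C i) \<le> (\<Sum>i\<in>{0<..<N}. Re (dS i X))"
    proof (rule sum_mono)
      fix i assume "i \<in> {0<..<N}"
      from C[OF this X] show "- C i \<le> Re (dS i X)" by linarith
    qed
    thus ?thesis unfolding mangoldt_sum_1_decomp by (simp add: sum_negf)
  qed
  thus ?thesis by (rule that)
qed

end

section \<open>Primes congruent to 1 modulo powers of 3\<close>

text \<open>From \<open>ln n \<le> 2 * sqrt n\<close> the term is at most 2 over the cube of
  \<open>sqrt n\<close>, which is dominated by a telescoping difference of reciprocal square
  roots.\<close>

lemma sum_ln_over_square_le: "(\<Sum>n=2..X. ln (real n) / real n ^ 2) \<le> 4"
proof (cases "X \<ge> 2")
  case True
  have "(\<Sum>n=2..X. ln (real n) / real n ^ 2) \<le> (\<Sum>n=2..X. 4 * (1 / sqrt (real (n - 1)) - 1 / sqrt (real n)))"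
  proof (intro sum_mono)
    fix n assume n: "n \<in> {2..X}"
    define a b where "a = sqrt (real n)" and "b = sqrt (real (n - 1))"
    have ab: "b > 0" "b \<le> a" "a ^ 2 - b ^ 2 = 1" "a ^ 2 = real n"
      using n by (auto simp: a_def b_def of_nat_diff)
    hence a: "a > 0" by linarith
    have "ln (real n) = 2 * ln a" unfolding ab(4) [symmetric] using a by (simp add: ln_realpow)
    also have "\<dots> \<le> 2 * a" using ln_le_minus_one[OF a] by simp
    finally have "ln (real n) / real n ^ 2 \<le> 2 * a / real n ^ 2"
      by (intro divide_right_mono) auto
    also have "\<dots> = 2 / a ^ 3"
    proof -
      have "real n ^ 2 = a * a ^ 3"
        unfolding ab(4) [symmetric] by (simp only: power2_eq_square power3_eq_cube mult.assoc)
      thus ?thesis using a by simp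
    qed
    also have "\<dots> \<le> 4 * (1 / ((a + b) * (a * b)))"
    proof -
      have "(a + b) * (a * b) \<le> (2 * a) * (a * a)"
        using ab a by (intro mult_mono) auto
      hence "(a + b) * (a * b) \<le> 2 * a ^ 3" by (simp add: power3_eq_cube)
      hence "4 / (2 * a ^ 3) \<le> 4 / ((a + b) * (a * b))"
        using a ab(1) by (intro divide_left_mono mult_pos_pos add_pos_pos) auto
      thus ?thesis by simp
    qed
    also have "1 / ((a + b) * (a * b)) = (a ^ 2 - b ^ 2) / ((a + b) * (a * b))" by (simp only: ab(3))
    also have "\<dots> = 1 / b - 1 / a"
    proof -
      have "a ^ 2 - b ^ 2 = (a + b) * (a - b)" by (simp add: power2_eq_square algebra_simps)
      hence "(a ^ 2 - b ^ 2) / ((a + b) * (a * b)) = (a - b) / (a * b)"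
        using a ab(1) by simp
      thus ?thesis using a ab(1) by (simp add: diff_divide_distrib)
    qed
    finally show "ln (real n) / real n ^ 2 \<le> 4 * (1 / sqrt (real (n - 1)) - 1 / sqrt (real n))"
      by (simp add: a_def b_def)
  qed
  also have "\<dots> = 4 * (\<Sum>n=2..X. 1 / sqrt (real (n - 1)) - 1 / sqrt (real n))"
    by (simp add: sum_distrib_left)
  also have "(\<Sum>n=2..X. 1 / sqrt (real (n - 1)) - 1 / sqrt (real n)) = 1 - 1 / sqrt (real X)"
    using True by (induction X rule: dec_induct) auto
  also have "4 * (1 - 1 / sqrt (real X)) \<le> 4" by simp
  finally show ?thesis .
qed auto

text \<open>Only powers \<open>p ^ i\<close> with \<open>i \<ge> 2\<close> contribute. For fixed
  \<open>p\<close> they form a geometric series of ratio at most 1/2, with sum at most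
  \<open>2 * ln p / p ^ 2\<close>.\<close>

lemma sum_mangoldt_nonprime_le:
  "(\<Sum>n | n \<in> {1..X} \<and> \<not> prime n. mangoldt n / real n) \<le> 8"
proof -
  define P where "P = {p \<in> {2..X}. prime p}"
  have "(\<Sum>n | n \<in> {1..X} \<and> \<not> prime n. mangoldt n / real n) =
          (\<Sum>n | n \<in> {1..X} \<and> \<not> prime n \<and> primepow n. mangoldt n / real n)"
    by (rule sum.mono_neutral_right) (auto simp: mangoldt_def)
  also have "\<dots> \<le> (\<Sum>n\<in>(\<lambda>(p, i). p ^ i) ` (P \<times> {2..X}). mangoldt n / real n)"
  proof (rule sum_mono2)
    show "{n. n \<in> {1..X} \<and> \<not> prime n \<and> primepow n} \<subseteq> (\<lambda>(p, i). p ^ i) ` (P \<times> {2..X})"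
    proof safe
      fix n assume n: "n \<in> {1..X}" "\<not> prime n" "primepow n"
      then obtain p i where pi: "prime p" "i > 0" "n = p ^ i" by (auto simp: primepow_def)
      with n have i: "i \<ge> 2" by (cases "i = 1") auto
      have p: "p \<ge> 2" using pi prime_ge_2_nat by blast
      have "p ^ 1 \<le> p ^ i" using pi p by (intro power_increasing) auto
      moreover have "i < p ^ i" using p by (intro power_gt_expt) auto
      ultimately have "(p, i) \<in> P \<times> {2..X}" using n pi i p by (auto simp: P_def)
      thus "n \<in> (\<lambda>(p, i). p ^ i) ` (P \<times> {2..X})" using pi by force
    qed
  qed (auto simp: P_def intro!: divide_nonneg_nonneg mangoldt_nonneg)
  also have "\<dots> \<le> (\<Sum>(p, i)\<in>P \<times> {2..X}. mangoldt (p ^ i) / real (p ^ i))"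
    by (rule order_trans[OF sum_image_le])
       (auto simp: P_def case_prod_unfold intro!: divide_nonneg_nonneg mangoldt_nonneg)
  also have "\<dots> = (\<Sum>p\<in>P. \<Sum>i=2..X. mangoldt (p ^ i) / real (p ^ i))"
    by (rule sum.cartesian_product [symmetric])
  also have "\<dots> \<le> (\<Sum>p\<in>P. 2 * (ln (real p) / real p ^ 2))"
  proof (intro sum_mono)
    fix p assume "p \<in> P"
    hence p: "prime p" "p \<ge> 2" by (auto simp: P_def)
    have geo: "(\<Sum>i=2..X. (1 / real p) ^ i) \<le> 2 / real p ^ 2"
    proof -
      have "(\<Sum>i=2..X. (1 / real p) ^ i) * (1 - 1 / real p) \<le> (1 / real p) ^ 2"
      proof (cases "X \<ge> 2")
        case True
        have "(1 / real p) ^ Suc X \<ge> 0" by simp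
        thus ?thesis using sum_gp_multiplied[OF True, of "1 / real p"] by (subst mult.commute) linarith
      qed auto
      moreover have "1 / 2 \<le> 1 - 1 / real p" using p by (simp add: field_simps)
      moreover have "(\<Sum>i=2..X. (1 / real p) ^ i) \<ge> 0" by (intro sum_nonneg) auto
      ultimately have "(\<Sum>i=2..X. (1 / real p) ^ i) * (1 / 2) \<le> (1 / real p) ^ 2"
        by (meson mult_left_mono order_trans)
      thus ?thesis by (simp add: power_divide)
    qed
    have "(\<Sum>i=2..X. mangoldt (p ^ i) / real (p ^ i)) = (\<Sum>i=2..X. ln (real p) * (1 / real p) ^ i)"
      using p by (intro sum.cong refl) (simp add: power_divide)
    also have "\<dots> = ln (real p) * (\<Sum>i=2..X. (1 / real p) ^ i)" by (simp only: sum_distrib_left)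
    also have "\<dots> \<le> ln (real p) * (2 / real p ^ 2)" using p by (intro mult_left_mono geo) auto
    finally show "(\<Sum>i=2..X. mangoldt (p ^ i) / real (p ^ i)) \<le> 2 * (ln (real p) / real p ^ 2)"
      by (simp only: mult.commute times_divide_eq_right)
  qed
  also have "\<dots> \<le> (\<Sum>n=2..X. 2 * (ln (real n) / real n ^ 2))"
    by (intro sum_mono2) (auto simp: P_def)
  also have "\<dots> = 2 * (\<Sum>n=2..X. ln (real n) / real n ^ 2)" by (simp only: sum_distrib_left)
  also have "\<dots> \<le> 8" using sum_ln_over_square_le[of X] by simp
  finally show ?thesis .
qed

definition prime_sum_1 :: "nat \<Rightarrow> nat \<Rightarrow> real" where
  "prime_sum_1 m X = (\<Sum>p | p \<in> {1..X} \<and> prime p \<and> [p = 1] (mod m). ln (real p) / real p)"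

lemma prime_sum_1_ge:
  "prime_sum_1 m X \<ge> (\<Sum>n | n \<in> {1..X} \<and> [n = 1] (mod m). mangoldt n / real n) - 8"
proof -
  have "(\<Sum>n | n \<in> {1..X} \<and> [n = 1] (mod m). mangoldt n / real n) \<le>
          (\<Sum>n\<in>{p. p \<in> {1..X} \<and> prime p \<and> [p = 1] (mod m)} \<union> {n. n \<in> {1..X} \<and> \<not> prime n}.
             mangoldt n / real n)"
    by (intro sum_mono2) (auto intro!: divide_nonneg_nonneg mangoldt_nonneg)
  also have "\<dots> = (\<Sum>p | p \<in> {1..X} \<and> prime p \<and> [p = 1] (mod m). mangoldt p / real p) +
                  (\<Sum>n | n \<in> {1..X} \<and> \<not> prime n. mangoldt n / real n)"
    by (intro sum.union_disjoint) auto
  also have "(\<Sum>p | p \<in> {1..X} \<and> prime p \<and> [p = 1] (mod m). mangoldt p / real p) = prime_sum_1 m X"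
    unfolding prime_sum_1_def by (intro sum.cong) auto
  finally show ?thesis using sum_mangoldt_nonprime_le[of X] by linarith
qed

text \<open>Grouped in threes, the series is \<open>1 - 1/2\<close> followed by nonnegative groups,
  so its partial sums at multiples of 3 stay above 1/2; for \<open>L1 = 0\<close> they would tend to
  0.\<close>

lemma L1_nonzero_if_mod_3:
  assumes "bounded_character \<chi> B"
    and \<chi>: "\<And>n. \<chi> n = (if n mod 3 = 1 then 1 else if n mod 3 = 2 then -1 else 0)"
  shows   "bounded_character.L1 \<chi> \<noteq> 0"
proof
  interpret bounded_character \<chi> B by fact
  assume "L1 = 0"
  have part: "Re (L1_partial (3 * Suc K)) \<ge> 1 / 2" for K
  proof (induction K)
    case 0
    have "{1..3 * Suc 0} = {1, 2, 3}" by auto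
    thus ?case unfolding L1_partial_def by (simp add: \<chi>)
  next
    case (Suc K)
    have "{1..3 * Suc (Suc K)} = insert (3 * K + 6) (insert (3 * K + 5) (insert (3 * K + 4) {1..3 * Suc K}))"
      by auto
    hence "L1_partial (3 * Suc (Suc K)) = L1_partial (3 * Suc K) +
             (1 / of_nat (3 * K + 4) - 1 / of_nat (3 * K + 5))"
    proof -
      have "(3 * K + 4) mod 3 = 1" "(3 * K + 5) mod 3 = 2" "(3 * K + 6) mod 3 = 0" by presburger+
      hence "\<chi> (3 * K + 4) = 1" "\<chi> (3 * K + 5) = -1" "\<chi> (3 * K + 6) = 0" by (simp_all only: \<chi>) simp_all
      thus ?thesis unfolding L1_partial_def
        by (subst \<open>{1..3 * Suc (Suc K)} = _\<close>) (simp add: algebra_simps)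
    qed
    hence "Re (L1_partial (3 * Suc (Suc K))) =
        Re (L1_partial (3 * Suc K)) + (1 / real (3 * K + 4) - 1 / real (3 * K + 5))"
      by (simp only: plus_complex.sel minus_complex.sel Re_divide_of_nat one_complex.sel)
    moreover have "1 / real (3 * K + 4) - 1 / real (3 * K + 5) \<ge> 0" by (simp add: field_simps)
    ultimately show ?case using Suc by linarith
  qed
  obtain K :: nat where K: "real K > 2 * B" using reals_Archimedean2 by blast
  have "1 / 2 \<le> norm (L1_partial (3 * Suc K))"
    using part[of K] abs_Re_le_cmod[of "L1_partial (3 * Suc K)"] by linarith
  also have "\<dots> \<le> B / real (Suc (3 * Suc K))"
    using L1_partial_bound[of "3 * Suc K"] \<open>L1 = 0\<close> by simp
  finally have "real (Suc (3 * Suc K)) \<le> 2 * B" by (simp add: field_simps)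
  thus False using K by simp
qed

text \<open>For \<open>j = 0\<close> this is Mertens' estimate for all primes. For
  \<open>j > 0\<close> there is a primitive root, and the single L-value to be checked belongs to
  the character modulo 3.\<close>

lemma prime_sum_1_power_3:
  obtains C where "\<And>X. X > 0 \<Longrightarrow> real (totient (3 ^ j)) * prime_sum_1 (3 ^ j) X \<ge> ln (real X) - C"
proof (cases "j = 0")
  case True
  have "prime_sum_1 1 X \<ge> ln (real X) - 9" if "X > 0" for X
  proof -
    have "{n. n \<in> {1..X} \<and> [n = 1] (mod 1)} = {1..X}" by (auto simp: cong_def)
    thus ?thesis using prime_sum_1_ge[of X 1] sum_mangoldt_over_ge[OF that] by simp
  qed
  thus ?thesis using True by (intro that[of 9]) auto
next
  case False
  \<comment> \<open>A single \<open>g\<close> generates the units modulo all powers of 3 at once,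
    hence also modulo 3, where it must be 2.\<close>
  have "prime (3 :: nat)" "odd (3 :: nat)" by simp_all
  then obtain g where g: "\<forall>k>0. residue_primroot (3 ^ k) g"
    by (rule residue_primroot_odd_prime_power_exists)
  have "1 < (3 :: nat) ^ j" using False by (intro one_less_power) auto
  then interpret primroot "3 ^ j" g
    using False g by unfold_locales auto
  have g3: "[g = 2] (mod 3)"
  proof -
    have "residue_primroot 3 g" using g[rule_format, of 1] by simp
    hence "coprime 3 g" "ord 3 g = 2" by (simp_all add: residue_primroot_def)
    hence "g mod 3 \<noteq> 0" "g mod 3 \<noteq> 1"
      using ord_divides[of g 1 3] by (auto simp: cong_def dvd_eq_mod_eq_0 [symmetric] coprime_absorb_left)
    thus ?thesis by (simp add: cong_def)
  qed
  have nz: "dL1 k \<noteq> 0" if k: "2 * k = N" for k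
  proof (rule L1_nonzero_if_mod_3[OF bounded_character_dchar])
    show k': "0 < k" "k < N" using k N_pos by auto
    \<comment> \<open>As \<open>\<omega> ^ k = -1\<close>, the character takes the value -1 to the
      power \<open>ind n\<close>. Since \<open>n\<close> is congruent to \<open>2 ^ ind n\<close>
      modulo 3, this sign depends only on \<open>n mod 3\<close>.\<close>
    have "\<omega> ^ k \<noteq> 1" using k' by (auto simp: \<omega>_power_eq_1_iff dest: dvd_imp_le)
    moreover have "(\<omega> ^ k) ^ 2 = 1" by (metis \<omega>_power_N k mult.commute power_mult)
    ultimately have \<omega>k: "\<omega> ^ k = -1" by (simp add: power2_eq_1_iff)
    fix n
    show "dchar k n = (if n mod 3 = 1 then 1 else if n mod 3 = 2 then - 1 else 0)"
    proof (cases "coprime n (3 ^ j)")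
      case True
      have "[g ^ ind n = n] (mod 3)"
        using power_ind[OF True] by (rule cong_dvd_modulus_nat) (use \<open>j \<noteq> 0\<close> in simp)
      moreover have "[g ^ ind n = 2 ^ ind n] (mod 3)" using g3 by (rule cong_pow)
      ultimately have n: "n mod 3 = 2 ^ ind n mod 3" by (simp add: cong_def)
      have "(2 :: nat) ^ i mod 3 = (if even i then 1 else 2)" for i
      proof (induction i)
        case (Suc i)
        have "(2 :: nat) ^ Suc i mod 3 = 2 * (2 ^ i mod 3) mod 3" by (simp add: mod_mult_right_eq)
        thus ?case unfolding Suc.IH by simp
      qed simp
      thus ?thesis using True n by (simp add: dchar_def power_mult \<omega>k)
    next
      case False
      have "3 dvd n"
      proof (rule ccontr)
        assume "\<not> 3 dvd n"
        hence "coprime 3 n" using \<open>prime 3\<close> by (rule prime_imp_coprime[rotated])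
        thus False using False by (simp add: coprime_commute)
      qed
      thus ?thesis using False by (simp add: dchar_def)
    qed
  qed
  \<comment> \<open>A number up to \<open>X\<close> that is not coprime to \<open>3 ^ j\<close> is 3
    or not a prime, so the terms left out add up to at most \<open>ln 3 + 8\<close>.\<close>
  have cop: "mangoldt_sum_coprime X \<ge> ln (real X) - 1 - ln 3 - 8" if "X > 0" for X
  proof -
    have "ln (real X) - 1 \<le> (\<Sum>n=1..X. mangoldt n / real n)" by (rule sum_mangoldt_over_ge[OF that])
    also have "\<dots> \<le> (\<Sum>n\<in>{n. n \<in> {1..X} \<and> coprime n (3 ^ j)} \<union>
                     ({3} \<union> {n. n \<in> {1..X} \<and> \<not> prime n}). mangoldt n / real n)"
    proof (intro sum_mono2)
      show "{1..X} \<subseteq> {n. n \<in> {1..X} \<and> coprime n (3 ^ j)} \<union> ({3} \<union> {n. n \<in> {1..X} \<and> \<not> prime n})"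
        by (auto intro!: primes_coprime)
    qed (auto intro!: divide_nonneg_nonneg mangoldt_nonneg)
    also have "\<dots> \<le> mangoldt_sum_coprime X + (\<Sum>n\<in>{3} \<union> {n. n \<in> {1..X} \<and> \<not> prime n}. mangoldt n / real n)"
      unfolding mangoldt_sum_coprime_def
      by (subst sum_Un) (auto intro!: sum_nonneg divide_nonneg_nonneg mangoldt_nonneg)
    finally have "ln (real X) - 1 \<le> mangoldt_sum_coprime X +
        (\<Sum>n\<in>{3} \<union> {n. n \<in> {1..X} \<and> \<not> prime n}. mangoldt n / real n)" .
    moreover have "(\<Sum>n\<in>{3} \<union> {n. n \<in> {1..X} \<and> \<not> prime n}. mangoldt n / real n) =
       ln 3 / 3 + (\<Sum>n | n \<in> {1..X} \<and> \<not> prime n. mangoldt n / real n)"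
      by (subst sum.union_disjoint) auto
    moreover have "ln 3 / 3 \<le> ln (3 :: real)" by simp
    ultimately show ?thesis using sum_mangoldt_nonprime_le[of X] by linarith
  qed
  obtain C where C: "\<And>X. X > 0 \<Longrightarrow> real N * mangoldt_sum_1 X \<ge> mangoldt_sum_coprime X - C"
    using mangoldt_sum_1_ge[OF nz] by blast
  show ?thesis
  proof (rule that[of "1 + ln 3 + 8 + C + real N * 8"])
    fix X :: nat assume X: "X > 0"
    have "real N * mangoldt_sum_1 X \<le> real N * (prime_sum_1 (3 ^ j) X + 8)"
      using prime_sum_1_ge[of X "3 ^ j"] unfolding mangoldt_sum_1_def by (intro mult_left_mono) auto
    thus "real (totient (3 ^ j)) * prime_sum_1 (3 ^ j) X \<ge> ln (real X) - (1 + ln 3 + 8 + C + real N * 8)"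
      using C[OF X] cop[OF X] unfolding N_def distrib_left by linarith
  qed
qed

section \<open>Moduli with a small period\<close>

text \<open>All multiples of \<open>n div gcd n Q\<close> satisfy the divisibility, and rounding
  their number down loses at most 1.\<close>

lemma card_dvd_mult_ge:
  assumes "n > 0" "Q > 0"
  shows   "real (card {l \<in> {1..X}. n dvd Q * l}) \<ge> real X * real (gcd n Q) / real n - 1"
proof -
  define e where "e = n div gcd n Q"
  have n: "n = e * gcd n Q" by (simp add: e_def)
  have e: "e > 0" using assms n by (intro Nat.gr0I) auto
  have "(\<lambda>k. e * k) ` {1..X div e} \<subseteq> {l \<in> {1..X}. n dvd Q * l}"
  proof safe
    fix k assume k: "k \<in> {1..X div e}"
    have "e * k \<le> e * (X div e)" using k by (intro mult_le_mono2) auto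
    also have "\<dots> \<le> X" by simp
    finally show "e * k \<in> {1..X}" using e k by auto
    have "e * gcd n Q dvd e * Q" by (intro mult_dvd_mono) auto
    hence "n dvd e * Q" using n by simp
    thus "n dvd Q * (e * k)" by (metis dvd_mult2 mult.assoc mult.commute)
  qed
  hence "card ((\<lambda>k. e * k) ` {1..X div e}) \<le> card {l \<in> {1..X}. n dvd Q * l}"
    by (intro card_mono) auto
  moreover have "card ((\<lambda>k. e * k) ` {1..X div e}) = X div e"
    using e by (subst card_image) (auto simp: inj_on_def)
  ultimately have "real (X div e) \<le> real (card {l \<in> {1..X}. n dvd Q * l})" by simp
  moreover have "real X / real e - 1 \<le> real (X div e)"
  proof -
    have "X < e * (X div e + 1)" using e by (simp add: dividend_less_times_div)
    hence "real X \<le> real e * (real (X div e) + 1)"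
      by (metis of_nat_1 of_nat_add of_nat_le_iff of_nat_mult less_imp_le)
    thus ?thesis using e by (simp add: field_simps)
  qed
  moreover have "real X * real (gcd n Q) / real n = real X / real e"
  proof -
    have "real n = real e * real (gcd n Q)" using n by (metis of_nat_mult)
    thus ?thesis using assms by simp
  qed
  ultimately show ?thesis by linarith
qed

text \<open>The powers in question are distinct divisors of \<open>gcd n (q ^ J)\<close>, and the
  totients of all its divisors add up to it.\<close>

lemma sum_totient_powers_le_gcd:
  fixes n q J :: nat
  assumes "q > 1"
  shows   "(\<Sum>j | j \<le> J \<and> q ^ j dvd n. totient (q ^ j)) \<le> gcd n (q ^ J)"
proof -
  have inj: "inj_on (\<lambda>j. q ^ j) {j. j \<le> J \<and> q ^ j dvd n}"
    using assms by (auto simp: inj_on_def)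
  have "(\<Sum>j | j \<le> J \<and> q ^ j dvd n. totient (q ^ j)) =
          (\<Sum>d\<in>(\<lambda>j. q ^ j) ` {j. j \<le> J \<and> q ^ j dvd n}. totient d)"
    by (subst sum.reindex[OF inj]) simp
  also have "\<dots> \<le> (\<Sum>d | d dvd gcd n (q ^ J). totient d)"
    using assms by (intro sum_mono2) (auto simp: le_imp_power_dvd)
  also have "\<dots> = gcd n (q ^ J)" by (rule totient_divisor_sum)
  finally show ?thesis .
qed

text \<open>The primes modulo which Fermat's theorem makes \<open>L\<close> a period of
  \<open>a ^ j\<close> for \<open>j > 0\<close>, whatever the base \<open>a\<close>.\<close>

definition shifted_divisor_primes :: "nat \<Rightarrow> nat set" where
  "shifted_divisor_primes L = {p. prime p \<and> (p - 1) dvd L}"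

lemma finite_shifted_divisor_primes:
  assumes "L > 0"
  shows   "finite (shifted_divisor_primes L)"
proof (rule finite_subset)
  show "shifted_divisor_primes L \<subseteq> {..L + 1}"
    using assms by (auto simp: shifted_divisor_primes_def dest!: dvd_imp_le)
qed auto

text \<open>After swapping the sums, a prime \<open>p \<le> X\<close> counts once for each
  \<open>l\<close> with \<open>p - 1 dvd 3 ^ J * l\<close>, so at least
  \<open>X * gcd (p - 1) (3 ^ J) / (p - 1) - 1\<close> times. The gcd dominates the totients of the
  powers \<open>3 ^ j\<close> dividing \<open>p - 1\<close>, and the losses of 1 cost at most
  \<open>4 * X\<close> by Chebyshev's bound.\<close>

lemma sum_shifted_divisor_primes_ge:
  fixes J X :: nat
  assumes "X > 0"
  shows   "(\<Sum>l=1..X. \<Sum>p\<in>shifted_divisor_primes (3 ^ J * l). ln (real p)) \<ge>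
             real X * (\<Sum>j\<le>J. real (totient (3 ^ j)) * prime_sum_1 (3 ^ j) X) - 4 * real X"
proof -
  define Q :: nat where "Q = 3 ^ J"
  define P where "P = {p \<in> {1..X}. prime p}"
  have P: "p > 0" "p - 1 > 0" "ln (real p) \<ge> 0" "prime p" if "p \<in> P" for p
    using that prime_ge_2_nat[of p] by (auto simp: P_def)
  have fin: "finite P" by (simp add: P_def)
  have "(\<Sum>j\<le>J. real (totient (3 ^ j)) * prime_sum_1 (3 ^ j) X) =
          (\<Sum>j\<le>J. \<Sum>p | p \<in> P \<and> 3 ^ j dvd p - 1. real (totient (3 ^ j)) * (ln (real p) / real p))"
  proof (intro sum.cong refl)
    fix j
    have "[p = 1] (mod 3 ^ j) \<longleftrightarrow> 3 ^ j dvd p - 1" if "p \<in> P" for p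
      using P(1)[OF that] by (intro cong_altdef_nat) auto
    hence "{p. p \<in> {1..X} \<and> prime p \<and> [p = 1] (mod 3 ^ j)} = {p. p \<in> P \<and> 3 ^ j dvd p - 1}"
      by (auto simp: P_def)
    thus "real (totient (3 ^ j)) * prime_sum_1 (3 ^ j) X =
            (\<Sum>p | p \<in> P \<and> 3 ^ j dvd p - 1. real (totient (3 ^ j)) * (ln (real p) / real p))"
      by (simp only: prime_sum_1_def sum_distrib_left)
  qed
  also have "\<dots> = (\<Sum>p\<in>P. \<Sum>j | j \<in> {..J} \<and> 3 ^ j dvd p - 1. real (totient (3 ^ j)) * (ln (real p) / real p))"
    using fin by (intro sum.swap_restrict) auto
  also have "\<dots> = (\<Sum>p\<in>P. real (\<Sum>j | j \<le> J \<and> 3 ^ j dvd p - 1. totient (3 ^ j)) * (ln (real p) / real p))"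
    by (simp only: of_nat_sum sum_distrib_right atMost_iff)
  also have "\<dots> \<le> (\<Sum>p\<in>P. real (gcd (p - 1) Q) * (ln (real p) / real p))"
    unfolding Q_def
    by (intro sum_mono mult_right_mono of_nat_mono sum_totient_powers_le_gcd divide_nonneg_nonneg P) auto
  also have "\<dots> \<le> (\<Sum>p\<in>P. real (gcd (p - 1) Q) * (ln (real p) / real (p - 1)))"
    by (intro sum_mono mult_left_mono divide_left_mono P mult_pos_pos) (auto dest: P)
  finally have "real X * (\<Sum>j\<le>J. real (totient (3 ^ j)) * prime_sum_1 (3 ^ j) X) \<le>
      real X * (\<Sum>p\<in>P. real (gcd (p - 1) Q) * (ln (real p) / real (p - 1)))"
    by (intro mult_left_mono) auto
  also have "\<dots> = (\<Sum>p\<in>P. ln (real p) * (real X * real (gcd (p - 1) Q) / real (p - 1) - 1)) + (\<Sum>p\<in>P. ln (real p))"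
    by (simp add: sum_distrib_left algebra_simps sum_subtractf)
  also have "\<dots> \<le> (\<Sum>p\<in>P. ln (real p) * real (card {l \<in> {1..X}. p - 1 dvd Q * l})) + 4 * real X"
  proof (intro add_mono sum_mono mult_left_mono card_dvd_mult_ge)
    have "(\<Sum>p\<in>P. ln (real p)) = (\<Sum>p\<in>P. mangoldt p)"
      by (intro sum.cong) (auto simp: P_def)
    also have "\<dots> \<le> chebyshev_psi X"
      unfolding chebyshev_psi_def by (intro sum_mono2) (auto simp: P_def mangoldt_nonneg)
    also have "\<dots> \<le> 4 * real X" by (rule chebyshev_psi_le)
    finally show "(\<Sum>p\<in>P. ln (real p)) \<le> 4 * real X" .
  qed (auto simp: Q_def dest: P)
  also have "(\<Sum>p\<in>P. ln (real p) * real (card {l \<in> {1..X}. p - 1 dvd Q * l})) =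
               (\<Sum>p\<in>P. \<Sum>l | l \<in> {1..X} \<and> p - 1 dvd Q * l. ln (real p))"
    by (simp add: mult.commute)
  also have "\<dots> = (\<Sum>l=1..X. \<Sum>p | p \<in> P \<and> p - 1 dvd Q * l. ln (real p))"
    using fin by (intro sum.swap_restrict) auto
  also have "\<dots> \<le> (\<Sum>l=1..X. \<Sum>p\<in>shifted_divisor_primes (Q * l). ln (real p))"
  proof (intro sum_mono sum_mono2 finite_shifted_divisor_primes)
    fix l p assume "p \<in> shifted_divisor_primes (Q * l) - {p. p \<in> P \<and> p - 1 dvd Q * l}"
    hence "p \<ge> 1" using prime_ge_1_nat by (auto simp: shifted_divisor_primes_def)
    thus "ln (real p) \<ge> 0" by simp
  qed (auto simp: P_def shifted_divisor_primes_def Q_def)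
  finally show ?thesis by (simp add: Q_def)
qed

text \<open>
  For \<open>L = 3 ^ J * l\<close> with \<open>l \<le> X\<close>, the logarithm of the product is about \<open>(J + 1) ln X\<close>
  on average, while \<open>ln L\<close> is at most about \<open>ln X\<close>.
\<close>

theorem prod_shifted_divisor_primes_gt_power:
  "\<exists>L\<ge>2. L ^ K < \<Prod>(shifted_divisor_primes L)"
proof (rule ccontr)
  assume "\<not> ?thesis"
  hence le: "\<Prod>(shifted_divisor_primes L) \<le> L ^ K" if "L \<ge> 2" for L
    using that by (meson not_less)
  \<comment> \<open>The indices \<open>j \<le> J\<close> supply \<open>K + 2\<close> copies of
    \<open>ln X\<close> against the \<open>K\<close> copies allowed by the assumed bound, so
    \<open>ln X\<close> would be bounded. Moreover \<open>J \<ge> 1\<close> ensures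
    \<open>L \<ge> 3\<close>.\<close>
  define J where "J = K + 1"
  have "\<exists>C. \<forall>j. \<forall>X>0. real (totient (3 ^ j)) * prime_sum_1 (3 ^ j) X \<ge> ln (real X) - C j"
    by (intro choice allI) (metis prime_sum_1_power_3)
  then obtain C where C: "\<And>j X. X > 0 \<Longrightarrow>
      real (totient (3 ^ j)) * prime_sum_1 (3 ^ j) X \<ge> ln (real X) - C j" by blast
  define D where "D = (\<Sum>j\<le>J. C j) + 4 + real K * ln (3 ^ J)"
  have *: "ln (real X) \<le> D" if X: "X > 0" for X
  proof -
    have "real X * (\<Sum>j\<le>J. ln (real X) - C j) - 4 * real X \<le>
            (\<Sum>l=1..X. \<Sum>p\<in>shifted_divisor_primes (3 ^ J * l). ln (real p))"
      by (rule order_trans[OF _ sum_shifted_divisor_primes_ge[OF X]])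
         (intro diff_right_mono mult_left_mono sum_mono C X, auto)
    also have "\<dots> \<le> (\<Sum>l=1..X. real K * (ln (3 ^ J) + ln (real X)))"
    proof (intro sum_mono)
      fix l assume l: "l \<in> {1..X}"
      define L where "L = 3 ^ J * l"
      have "(3 :: nat) ^ 1 * 1 \<le> L"
        unfolding L_def J_def using l by (intro mult_le_mono power_increasing) auto
      hence L: "L \<ge> 2" by simp
      have pos: "p > 0" if "p \<in> shifted_divisor_primes L" for p
        using that prime_gt_0_nat by (auto simp: shifted_divisor_primes_def)
      have "(\<Sum>p\<in>shifted_divisor_primes L. ln (real p)) = ln (\<Prod>p\<in>shifted_divisor_primes L. real p)"
        using L pos by (intro ln_prod [symmetric] finite_shifted_divisor_primes) auto
      also have "\<dots> = ln (real (\<Prod>(shifted_divisor_primes L)))" by simp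
      also have "\<dots> \<le> ln (real (L ^ K))"
        using L pos le[OF L] by (intro ln_mono of_nat_mono) (auto intro!: prod_pos)
      also have "\<dots> = real K * ln (real L)" using L by (simp add: ln_realpow)
      also have "ln (real L) = ln (3 ^ J) + ln (real l)" using l by (simp add: L_def ln_mult)
      also have "real K * (ln (3 ^ J) + ln (real l)) \<le> real K * (ln (3 ^ J) + ln (real X))"
        using l by (intro mult_left_mono add_left_mono) auto
      finally show "(\<Sum>p\<in>shifted_divisor_primes (3 ^ J * l). ln (real p)) \<le>
          real K * (ln (3 ^ J) + ln (real X))" by (simp add: L_def)
    qed
    also have "\<dots> = real X * (real K * (ln (3 ^ J) + ln (real X)))" by simp
    finally have "real X * ((\<Sum>j\<le>J. ln (real X) - C j) - 4) \<le>
        real X * (real K * (ln (3 ^ J) + ln (real X)))" by (simp only: algebra_simps)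
    hence "(\<Sum>j\<le>J. ln (real X) - C j) - 4 \<le> real K * (ln (3 ^ J) + ln (real X))"
      using X by (simp only: mult_le_cancel_left_pos of_nat_0_less_iff)
    moreover have "(\<Sum>j\<le>J. ln (real X) - C j) = (real K + 2) * ln (real X) - (\<Sum>j\<le>J. C j)"
      by (simp add: sum_subtractf J_def)
    ultimately have "2 * ln (real X) \<le> D" by (simp add: D_def algebra_simps)
    moreover have "ln (real X) \<ge> 0" using X by simp
    ultimately show ?thesis by linarith
  qed
  obtain X :: nat where X: "real X > exp D" using reals_Archimedean2 by blast
  hence "X > 0" by (metis exp_gt_zero less_trans of_nat_0_less_iff)
  with *[of X] X show False
    by (metis exp_gt_zero less_trans linorder_not_le ln_exp ln_less_cancel_iff)
qed

section \<open>Natural density\<close>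

text \<open>Applied with half of \<open>\<epsilon>\<close>, the hypothesis leaves room for
  \<open>C\<close>, which becomes negligible after division by \<open>2 * N + 1\<close>.\<close>

lemma has_natural_density_0I:
  assumes "\<And>\<epsilon>. \<epsilon> > 0 \<Longrightarrow>
     \<exists>C. \<forall>N. real (card (A \<inter> {- int N..int N})) \<le> \<epsilon> * real (2 * N + 1) + C"
  shows   "has_natural_density A 0"
proof -
  let ?d = "\<lambda>N. real (card (A \<inter> {- int N..int N})) / real (2 * N + 1)"
  have "?d \<longlonglongrightarrow> 0"
  proof (rule LIMSEQ_I)
    fix \<epsilon> :: real assume \<epsilon>: "\<epsilon> > 0"
    then obtain C where C: "\<And>N. real (card (A \<inter> {- int N..int N})) \<le> \<epsilon> / 2 * real (2 * N + 1) + C"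
      using assms[of "\<epsilon> / 2"] by auto
    obtain N0 :: nat where N0: "real N0 > 2 * C / \<epsilon>" using reals_Archimedean2 by blast
    have "norm (?d N - 0) < \<epsilon>" if "N \<ge> N0" for N
    proof -
      have "2 * C / \<epsilon> < real (2 * N + 1)" using N0 that by linarith
      hence "C < \<epsilon> / 2 * real (2 * N + 1)" using \<epsilon> by (simp add: field_simps)
      hence "real (card (A \<inter> {- int N..int N})) < \<epsilon> * real (2 * N + 1)"
        using C[of N] by (simp add: field_simps)
      thus ?thesis by (simp add: divide_less_eq del: of_nat_Suc)
    qed
    thus "\<exists>N0. \<forall>N\<ge>N0. norm (?d N - 0) < \<epsilon>" by blast
  qed
  hence "(\<lambda>N. ereal (?d N)) \<longlonglongrightarrow> ereal 0" by simp
  from lim_imp_Limsup[OF sequentially_bot this] lim_imp_Liminf[OF sequentially_bot this]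
  show ?thesis
    unfolding has_natural_density_def upper_natural_density_def lower_natural_density_def by blast
qed

text \<open>Within one residue class \<open>z\<close> is determined by \<open>z div m\<close>, which
  ranges over at most \<open>2 * A / m + 2\<close> integers.\<close>

lemma card_residues_in_interval:
  fixes m A :: int and V :: "int set"
  assumes "m > 0" "A \<ge> 0" "finite V"
  shows   "real (card {z \<in> {-A..A}. z mod m \<in> V}) \<le> real (card V) * (2 * real_of_int A / real_of_int m + 2)"
proof -
  have one: "real (card {z \<in> {-A..A}. z mod m = v}) \<le> 2 * real_of_int A / real_of_int m + 2" for v
  proof -
    have "inj_on (\<lambda>z. z div m) {z \<in> {-A..A}. z mod m = v}"
      by (rule inj_onI) (metis (mono_tags, lifting) div_mult_mod_eq mem_Collect_eq)
    moreover have "(\<lambda>z. z div m) ` {z \<in> {-A..A}. z mod m = v} \<subseteq> {(-A) div m..A div m}"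
      using assms(1) by (auto intro: zdiv_mono1)
    ultimately have "card {z \<in> {-A..A}. z mod m = v} \<le> card {(-A) div m..A div m}"
      by (intro card_inj_on_le) auto
    also have "\<dots> = nat (A div m - (-A) div m + 1)" by simp
    finally have "real (card {z \<in> {-A..A}. z mod m = v}) \<le> real (nat (A div m - (-A) div m + 1))"
      by simp
    moreover have "(-A) div m \<le> A div m" using assms by (intro zdiv_mono1) auto
    moreover have "real_of_int (A div m) \<le> real_of_int A / real_of_int m"
      by (rule real_of_int_div4)
    moreover have "real_of_int ((-A) div m) \<ge> real_of_int (- A) / real_of_int m - 1"
      using real_of_int_div3[of "-A" m] by linarith
    ultimately show ?thesis by simp
  qed
  have "{z \<in> {-A..A}. z mod m \<in> V} = (\<Union>v\<in>V. {z \<in> {-A..A}. z mod m = v})" by auto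
  hence "card {z \<in> {-A..A}. z mod m \<in> V} \<le> (\<Sum>v\<in>V. card {z \<in> {-A..A}. z mod m = v})"
    using card_UN_le[OF assms(3)] by simp
  hence "real (card {z \<in> {-A..A}. z mod m \<in> V}) \<le> (\<Sum>v\<in>V. real (card {z \<in> {-A..A}. z mod m = v}))"
    by (simp only: of_nat_sum [symmetric] of_nat_le_iff)
  also have "\<dots> \<le> (\<Sum>v\<in>V. 2 * real_of_int A / real_of_int m + 2)" by (intro sum_mono one)
  finally show ?thesis by simp
qed

section \<open>Periodicity of powers modulo a product of primes\<close>

lemma prod_primes_dvd:
  fixes x :: int
  assumes "finite A" "\<And>p. p \<in> A \<Longrightarrow> prime p" "\<And>p. p \<in> A \<Longrightarrow> int p dvd x"
  shows   "int (\<Prod>A) dvd x"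
  using assms
proof (induction A rule: finite_induct)
  case (insert p A)
  have "coprime p (\<Prod>A)"
    using insert by (intro prod_coprime_right primes_coprime) auto
  hence "coprime (int p) (int (\<Prod>A))" by (simp only: coprime_int_iff)
  moreover have "int (\<Prod>A) dvd x" using insert by blast
  moreover have "int p dvd x" using insert by blast
  ultimately have "int p * int (\<Prod>A) dvd x" by (intro divides_mult)
  moreover have "\<Prod>(insert p A) = p * \<Prod>A" using insert.hyps by simp
  ultimately show ?case by (simp only: of_nat_mult)
qed simp

text \<open>If \<open>p\<close> divides \<open>a\<close>, both powers vanish modulo \<open>p\<close>
  because \<open>j > 0\<close>; otherwise Fermat's theorem makes \<open>a ^ L\<close> congruent to
  1.\<close>

lemma power_add_period_cong_prime:
  fixes a :: int
  assumes "prime p" "(p - 1) dvd L" "j > 0"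
  shows   "int p dvd a ^ (j + L) - a ^ j"
proof (cases "int p dvd a")
  case True
  hence "int p dvd a ^ j" using assms(3) dvd_trans dvd_power by blast
  thus ?thesis by (simp add: power_add)
next
  case False
  obtain k where k: "L = (p - 1) * k" using assms(2) by blast
  define a' where "a' = nat (a mod int p)"
  have a': "[a = int a'] (mod int p)"
    using prime_gt_0_nat[OF assms(1)] by (simp add: a'_def cong_def)
  hence "\<not> p dvd a'" using False by (simp add: cong_dvd_iff)
  hence "[a' ^ (p - 1) = 1] (mod p)" using assms(1) by (intro fermat_theorem)
  hence "[int a' ^ (p - 1) = 1] (mod int p)" by (metis cong_int_iff of_nat_1 of_nat_power)
  with cong_pow[OF a', of "p - 1"] have "[a ^ (p - 1) = 1] (mod int p)" by (rule cong_trans)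
  hence "[(a ^ (p - 1)) ^ k = 1 ^ k] (mod int p)" by (rule cong_pow)
  hence "int p dvd a ^ L - 1" by (simp add: k power_mult cong_iff_dvd_diff)
  hence "int p dvd a ^ j * (a ^ L - 1)" by simp
  thus ?thesis by (simp add: power_add algebra_simps)
qed

text \<open>An exponent above \<open>L\<close> may be lowered by \<open>L\<close>; it stays
  positive, as the periodicity demands, until it lies in the range.\<close>

lemma powers_mod_subset:
  fixes a :: int
  assumes "L > 0"
  defines "m \<equiv> int (\<Prod>(shifted_divisor_primes L))"
  shows   "a ^ j mod m \<in> (\<lambda>j. a ^ j mod m) ` {..L}"
proof (induction j rule: less_induct)
  case (less j)
  show ?case
  proof (cases "j \<le> L")
    case False
    have "m dvd a ^ ((j - L) + L) - a ^ (j - L)"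
      unfolding m_def using False assms(1)
      by (intro prod_primes_dvd finite_shifted_divisor_primes power_add_period_cong_prime)
         (auto simp: shifted_divisor_primes_def)
    hence "a ^ j mod m = a ^ (j - L) mod m"
      using False by (simp add: mod_eq_dvd_iff)
    thus ?thesis using less.IH[of "j - L"] False assms(1) by simp
  qed auto
qed

section \<open>Counting the values of affine pieces through their residues\<close>

lemma linform_mod:
  assumes "length xs = M"
  shows   "(linform M b (map (\<lambda>x. x mod m) xs) + d) mod m = (linform M b xs + d) mod m"
proof -
  have "linform M b (map (\<lambda>x. x mod m) xs) mod m = linform M b xs mod m"
    unfolding linform_def
    by (subst (1 2) mod_sum_eq [symmetric])
       (use assms in \<open>auto intro!: arg_cong[of _ _ "\<lambda>x. x mod m"] sum.cong simp: mod_mult_right_eq\<close>)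
  thus ?thesis by (metis mod_add_left_eq)
qed

text \<open>The residue of an affine form depends only on the residues of the \<open>M\<close>
  entries.\<close>

lemma card_affine_residues:
  fixes E :: "int set" and b :: "nat \<Rightarrow> int" and d :: int and M :: nat
  assumes "finite ((\<lambda>x. x mod m) ` E)"
  defines "V \<equiv> (\<lambda>xs. (linform M b xs + d) mod m) ` ivecs M E"
  shows   "finite V" "card V \<le> card ((\<lambda>x. x mod m) ` E) ^ M"
proof -
  define W where "W = {xs. set xs \<subseteq> (\<lambda>x. x mod m) ` E \<and> length xs = M}"
  have W: "finite W" "card W = card ((\<lambda>x. x mod m) ` E) ^ M"
    unfolding W_def using assms by (auto intro: finite_lists_length_eq card_lists_length_eq)
  have sub: "V \<subseteq> (\<lambda>xs. (linform M b xs + d) mod m) ` W"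
  proof
    fix v assume "v \<in> V"
    then obtain xs where xs: "length xs = M" "set xs \<subseteq> E" "v = (linform M b xs + d) mod m"
      by (auto simp: V_def ivecs_def)
    hence "map (\<lambda>x. x mod m) xs \<in> W" by (auto simp: W_def)
    thus "v \<in> (\<lambda>xs. (linform M b xs + d) mod m) ` W"
      unfolding xs(3) linform_mod[OF xs(1), of b m d, symmetric] by (rule imageI)
  qed
  show "finite V" using W(1) sub by (rule finite_surj)
  have "card V \<le> card W" using W(1) sub by (rule surj_card_le)
  thus "card V \<le> card ((\<lambda>x. x mod m) ` E) ^ M" using W(2) by simp
qed

text \<open>For \<open>c \<noteq> 0\<close> the map \<open>y \<mapsto> c * y\<close> is injective;
  its values lie in an interval of radius \<open>c_max * N\<close> and in the residue classes of the
  affine form. For \<open>c = 0\<close> nothing solves the equation.\<close>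

lemma card_solutions_le:
  fixes m :: int
  assumes "m > 0" "finite ((\<lambda>x. x mod m) ` E)" "\<bar>c\<bar> \<le> c_max"
  shows   "real (card {y \<in> {- int N..int N}. \<exists>xs\<in>ivecs M E. solves M xs y (c, b, d)}) \<le>
             real (card ((\<lambda>x. x mod m) ` E)) ^ M * (2 * real_of_int c_max * real N / real_of_int m + 2)"
proof (cases "c = 0")
  case True
  have "0 \<le> c_max" using assms(3) by linarith
  thus ?thesis using True assms(1)
    by (simp add: solves_def)
next
  case False
  define V where "V = (\<lambda>xs. (linform M b xs + d) mod m) ` ivecs M E"
  note V = card_affine_residues[OF assms(2), of M b d, folded V_def]
  let ?Y = "{y \<in> {- int N..int N}. \<exists>xs\<in>ivecs M E. solves M xs y (c, b, d)}"
  let ?A = "c_max * int N"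
  have "card ?Y \<le> card {z \<in> {-?A..?A}. z mod m \<in> V}"
  proof (rule card_inj_on_le)
    show "inj_on ((*) c) ?Y" using False by (auto simp: inj_on_def)
    show "(*) c ` ?Y \<subseteq> {z \<in> {-?A..?A}. z mod m \<in> V}"
    proof safe
      fix y xs assume y: "y \<in> {- int N..int N}" and xs: "xs \<in> ivecs M E" "solves M xs y (c, b, d)"
      have "\<bar>c * y\<bar> \<le> ?A"
        unfolding abs_mult using y assms(3) by (intro mult_mono) auto
      thus "c * y \<in> {-?A..?A}" by auto
      show "c * y mod m \<in> V" using xs by (auto simp: V_def solves_def)
    qed
    show "finite {z \<in> {-?A..?A}. z mod m \<in> V}" by (rule finite_subset[of _ "{-?A..?A}"]) auto
  qed
  hence "real (card ?Y) \<le> real (card {z \<in> {-?A..?A}. z mod m \<in> V})" by simp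
  also have "\<dots> \<le> real (card V) * (2 * real_of_int ?A / real_of_int m + 2)"
    using assms V(1) by (intro card_residues_in_interval) auto
  also have "\<dots> \<le> real (card ((\<lambda>x. x mod m) ` E) ^ M) * (2 * real_of_int ?A / real_of_int m + 2)"
    using V(2) assms by (intro mult_right_mono of_nat_mono) (auto intro!: add_nonneg_nonneg divide_nonneg_nonneg)
  finally show ?thesis by (simp add: mult_ac)
qed

lemma card_piecewise_affine_image_le:
  fixes m :: int
  assumes "finite S" "\<And>xs. length xs = M \<Longrightarrow> \<exists>e\<in>S. solves M xs (f xs) e"
    and "\<And>e. e \<in> S \<Longrightarrow> \<bar>fst e\<bar> \<le> c_max"
    and "m > 0" "finite ((\<lambda>x. x mod m) ` E)"
  shows "real (card (f ` ivecs M E \<inter> {- int N..int N})) \<le>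
           real (card S) * (real (card ((\<lambda>x. x mod m) ` E)) ^ M * (2 * real_of_int c_max * real N / real_of_int m + 2))"
proof -
  define Y where "Y e = {y \<in> {- int N..int N}. \<exists>xs\<in>ivecs M E. solves M xs y e}" for e
  have finY: "finite (Y e)" for e
    by (rule finite_subset[of _ "{- int N..int N}"]) (auto simp: Y_def)
  have "f ` ivecs M E \<inter> {- int N..int N} \<subseteq> (\<Union>e\<in>S. Y e)"
    using assms(2) by (fastforce simp: Y_def ivecs_def)
  hence "card (f ` ivecs M E \<inter> {- int N..int N}) \<le> card (\<Union>e\<in>S. Y e)"
    using assms(1) finY by (intro card_mono) auto
  also have "\<dots> \<le> (\<Sum>e\<in>S. card (Y e))" by (rule card_UN_le[OF assms(1)])
  finally have "real (card (f ` ivecs M E \<inter> {- int N..int N})) \<le> (\<Sum>e\<in>S. real (card (Y e)))"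
    by (simp only: of_nat_sum [symmetric] of_nat_le_iff)
  also have "\<dots> \<le> (\<Sum>e\<in>S. real (card ((\<lambda>x. x mod m) ` E)) ^ M * (2 * real_of_int c_max * real N / real_of_int m + 2))"
  proof (rule sum_mono)
    fix e assume e: "e \<in> S"
    obtain c b d where [simp]: "e = (c, b, d)" by (cases e)
    show "real (card (Y e)) \<le> real (card ((\<lambda>x. x mod m) ` E)) ^ M * (2 * real_of_int c_max * real N / real_of_int m + 2)"
      using card_solutions_le[OF assms(4,5), of c c_max N M b d] assms(3)[OF e] by (simp add: Y_def)
  qed
  finally show ?thesis by simp
qed

text \<open>With the period \<open>L\<close>, the set \<open>E\<close> has at most
  \<open>n * (L + 1) \<le> n * L ^ 2\<close> residues, while the modulus can be made larger than any
  given power of \<open>L\<close>.\<close>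

lemma modulus_with_few_residues:
  fixes a :: "nat \<Rightarrow> int" and n M :: nat and B :: real
  defines "E \<equiv> (\<Union>i\<in>{1..n}. {a i ^ j | j :: nat. True})"
  obtains m :: int where "m > 0" "finite ((\<lambda>x. x mod m) ` E)"
    "B * real (card ((\<lambda>x. x mod m) ` E)) ^ M < real_of_int m"
proof -
  \<comment> \<open>Since \<open>k \<le> 2 ^ k \<le> L ^ k\<close>, the factor \<open>L ^ k\<close>
    absorbs all constants; the remaining \<open>L ^ (2 * M)\<close> covers the count of residues to
    the power \<open>M\<close>.\<close>
  obtain k :: nat where k: "real k \<ge> max 0 B * real n ^ M" using real_arch_simple by blast
  obtain L where L: "L \<ge> 2" "L ^ (k + 2 * M) < \<Prod>(shifted_divisor_primes L)"
    using prod_shifted_divisor_primes_gt_power by blast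
  define m where "m = int (\<Prod>(shifted_divisor_primes L))"
  have sub: "(\<lambda>x. x mod m) ` E \<subseteq> (\<Union>i\<in>{1..n}. (\<lambda>j. a i ^ j mod m) ` {..L})"
    using powers_mod_subset[of L] L(1) unfolding E_def m_def by fastforce
  have fin: "finite (\<Union>i\<in>{1..n}. (\<lambda>j. a i ^ j mod m) ` {..L})" by simp
  have "card ((\<lambda>x. x mod m) ` E) \<le> card (\<Union>i\<in>{1..n}. (\<lambda>j. a i ^ j mod m) ` {..L})"
    using fin sub by (rule card_mono)
  also have "card (\<Union>i\<in>{1..n}. (\<lambda>j. a i ^ j mod m) ` {..L}) \<le> (\<Sum>i\<in>{1..n}. card ((\<lambda>j. a i ^ j mod m) ` {..L}))"
    by (rule card_UN_le) auto
  also have "\<dots> \<le> (\<Sum>i\<in>{1..n}. card {..L})" by (intro sum_mono card_image_le) auto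
  also have "\<dots> = n * (L + 1)" by simp
  also have "\<dots> \<le> n * L ^ 2"
  proof (rule mult_le_mono2)
    have "L + 1 \<le> L * 2" using L(1) by simp
    also have "\<dots> \<le> L * L" using L(1) by (intro mult_le_mono2)
    finally show "L + 1 \<le> L ^ 2" by (simp add: power2_eq_square)
  qed
  finally have card: "card ((\<lambda>x. x mod m) ` E) \<le> n * L ^ 2" .
  have "B * real (card ((\<lambda>x. x mod m) ` E)) ^ M \<le> max 0 B * real (n * L ^ 2) ^ M"
    using card by (intro mult_mono power_mono of_nat_mono) auto
  also have "\<dots> = (max 0 B * real n ^ M) * real L ^ (2 * M)"
    by (simp add: power_mult_distrib power_mult)
  also have "\<dots> \<le> real L ^ k * real L ^ (2 * M)"
  proof (rule mult_right_mono)
    have "real k \<le> real (2 ^ k)" by (intro of_nat_mono less_imp_le less_exp)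
    also have "\<dots> \<le> real (L ^ k)" using L(1) by (intro of_nat_mono power_mono) auto
    finally show "max 0 B * real n ^ M \<le> real L ^ k" using k unfolding of_nat_power by linarith
  qed auto
  also have "\<dots> = real (L ^ (k + 2 * M))" by (simp add: power_add)
  also have "\<dots> < real (\<Prod>(shifted_divisor_primes L))" using L(2) by (simp only: of_nat_less_iff)
  finally have "B * real (card ((\<lambda>x. x mod m) ` E)) ^ M < real_of_int m" by (simp add: m_def)
  moreover have "m > 0" using L(2) unfolding m_def of_nat_0_less_iff by linarith
  ultimately show ?thesis using that finite_subset[OF sub fin] by blast
qed

theorem theoremB:
  fixes n M :: nat
    and a :: "nat \<Rightarrow> int"
    and E :: "int set"
    and f :: "int list \<Rightarrow> int"
  assumes "\<And>i. i \<in> {1..n} \<Longrightarrow> a i > 1"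
    and "E = (\<Union>i\<in>{1..n}. {a i ^ j | j :: nat. True})"
    and "presburger_definable_fun M f"
  shows "has_natural_density (f ` ivecs M E) 0"
proof (rule has_natural_density_0I)
  fix \<epsilon> :: real assume \<epsilon>: "\<epsilon> > 0"
  obtain S where S: "finite S" "\<And>xs. length xs = M \<Longrightarrow> \<exists>e\<in>S. solves M xs (f xs) e"
    using presburger_definable_fun_piecewise_affine[OF assms(3)] by blast
  define c_max where "c_max = (\<Sum>e\<in>S. \<bar>fst e\<bar>)"
  have c_max: "\<bar>fst e\<bar> \<le> c_max" if "e \<in> S" for e
    unfolding c_max_def using S(1) that by (intro member_le_sum) auto
  \<comment> \<open>The factor \<open>B\<close> is chosen so that the coefficient of
    \<open>2 * N\<close> in the final count is at most \<open>\<epsilon>\<close>.\<close>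
  obtain m where m: "m > 0" "finite ((\<lambda>x. x mod m) ` E)"
    "(real (card S) * real_of_int c_max / \<epsilon>) * real (card ((\<lambda>x. x mod m) ` E)) ^ M < real_of_int m"
    using modulus_with_few_residues[where a = a and n = n and M = M
            and B = "real (card S) * real_of_int c_max / \<epsilon>"]
    unfolding assms(2) by blast
  define r where "r = real (card ((\<lambda>x. x mod m) ` E)) ^ M"
  have small: "real (card S) * r * real_of_int c_max / real_of_int m \<le> \<epsilon>"
    using m(1,3) \<epsilon> by (simp add: r_def field_simps)
  show "\<exists>C. \<forall>N. real (card (f ` ivecs M E \<inter> {- int N..int N})) \<le> \<epsilon> * real (2 * N + 1) + C"
  \<comment> \<open>Each of the \<open>card S\<close> equations leaves at most \<open>2 * r\<close>
    from rounding, independently of \<open>N\<close>.\<close>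
  proof (intro exI[of _ "2 * real (card S) * r"] allI)
    fix N :: nat
    have "real (card (f ` ivecs M E \<inter> {- int N..int N})) \<le>
        real (card S) * (r * (2 * real_of_int c_max * real N / real_of_int m + 2))"
      unfolding r_def using S c_max m by (intro card_piecewise_affine_image_le)
    also have "\<dots> = (real (card S) * r * real_of_int c_max / real_of_int m) * (2 * real N) + 2 * real (card S) * r"
      by (simp add: algebra_simps)
    also have "\<dots> \<le> \<epsilon> * real (2 * N + 1) + 2 * real (card S) * r"
      using small \<epsilon> by (intro add_right_mono mult_mono) auto
    finally show "real (card (f ` ivecs M E \<inter> {- int N..int N})) \<le> \<epsilon> * real (2 * N + 1) + 2 * real (card S) * r" .
  qed
qed

end
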